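(* Let $|\psi\rangle$ be a pure state in $\mathcal{H}_1\otimes\cdots\otimes\mathcal{H}_n$, $n\ge 2$. If $|\psi\rangle$ is locally undetermined, then for any $1\le k\le n$ there exist an (ordinary) Schmidt decomposition $$|\psi\rangle=\sum_{i=1}^{M_k}\sqrt{\lambda_i}\,|i\rangle_k|\psi_i\rangle_{\bar k},\qquad \lambda_1,\dots,\lambda_{M_k}>0,\qquad ( * )$$ of $|\psi\rangle$ when treated as a bipartite state between $\mathcal{H}_k$ and $\mathcal{H}_{\bar k}$, and a complete partition $S_1,\dots,S_L$, $L\ge 2$, of $\{1,\dots,M_k\}$, such that for any $j\ne k$, $1\le l\ne l'\le L$, $r\in S_l$, $t\in S_{l'}$, it holds that $$\rho_j^{\psi_r}\perp\rho_j^{\psi_t}.\qquad ( ** )$$ Furthermore, $$R(\psi)=\left\{\sum_{j=1}^L \exp(\mathrm{i}\theta_j)\sum_{i\in S_j}\sqrt{\lambda_i}\,|i\rangle_k|\psi_i\rangle_{\bar k}\;:\; S_j \text{ satisfy the conditions above, and } 0\le\theta_1,\dots,\theta_L<2\pi\right\},$$ where $\lambda_i$, $|i\rangle_k$, $|\psi_i\rangle_{\bar k}$ are those of the Schmidt decomposition $( * )$ asserted to exist, and the set is taken over the complete partitions $S_1,\dots,S_L$ ($L\ge2$) of $\{1,\dots,M_k\}$ satisfying $( ** )$ and over the phases. Conversely, if there exists $1\le k\le n$ such that a Schmidt decomposition $( * )$ of $|\psi\rangle$ and a complete partition $S_1,\dots,S_L$, $L\ge 2$, of $\{1,\dots,M_k\}$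 satisfying $( ** )$ (for all $j\neq k$, $l\ne l'$, $r\in S_l$, $t\in S_{l'}$) can be found, then $|\psi\rangle$ is locally undetermined.
   Context: $\mathcal{H}_1,\dots,\mathcal{H}_n$ are finite-dimensional complex Hilbert spaces, and a pure state is a unit vector. $\mathrm{Tr}_i$ denotes the partial trace over $\mathcal{H}_i$. $\mathcal{H}_{\bar k}=\bigotimes_{i\ne k}\mathcal{H}_i$. In a Schmidt decomposition $\sum_{i=1}^{M_k}\sqrt{\lambda_i}\,|i\rangle_k|\psi_i\rangle_{\bar k}$, the vectors $|i\rangle_k$ are orthonormal in $\mathcal{H}_k$ and the vectors $|\psi_i\rangle_{\bar k}$ are orthonormal in $\mathcal{H}_{\bar k}$. For $j\ne k$, $\rho_j^{\psi_r}$ is the one-party reduced state of $|\psi_r\rangle_{\bar k}$ on $\mathcal{H}_j$, i.e. the partial trace of $|\psi_r\rangle\langle\psi_r|$ over all factors of $\mathcal{H}_{\bar k}$ other than $\mathcal{H}_j$. For density operators, $\rho\perp\sigma$ means that their supports are orthogonal. A complete partition of a set is a family of nonempty pairwise disjoint subsets whose union is the whole set. $R(\psi)$ is the set of pure states $|\phi\rangle\in\mathcal{H}_1\otimes\cdots\otimes\mathcal{H}_n$ such that $\mathrm{Tr}_i|\psi\rangle\langle\psi|=\mathrm{Tr}_i|\phi\rangle\langle\phi|$ for all $i=1,\dots,n$. The state $|\psi\rangle$ is locally undetermined (among pure states) if there exists $|\phi\rangle\in R(\psi)$ with $|\langle\phi|\psi\rangle|\ne 1$.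
   Formalization: The formula for R(ψ) from one fixed Schmidt decomposition is claimed only if n≥3 or the λ_i are distinct; for n=2 with repeated λ_i it fails (e.g. the Bell state), and R(ψ) is instead the union of these sets over all Schmidt decompositions of ψ. *)

theory Defs
  imports "HOL-Analysis.Analysis"
begin

(* Party i has the Hilbert space C^(d i).  For a finite set I of parties, the tensor product of
   the C^(d i), i in I, is the space of complex functions on multi_idx d I (coordinates in the
   product basis), extended by 0 outside multi_idx d I so that equality of vectors is equality of
   functions.  Operators on this space are likewise matrices indexed by multi_idx d I,
   extended by 0.  The single-party space H_k is the case I = {k}. *)

type_synonym qvec = "(nat \<Rightarrow> nat) \<Rightarrow> complex"
type_synonym qop = "(nat \<Rightarrow> nat) \<Rightarrow> (nat \<Rightarrow> nat) \<Rightarrow> complex"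

definition multi_idx :: "(nat \<Rightarrow> nat) \<Rightarrow> nat set \<Rightarrow> (nat \<Rightarrow> nat) set" where
  "multi_idx d I = (\<Pi>\<^sub>E i\<in>I. {..<d i})"

definition hspace :: "(nat \<Rightarrow> nat) \<Rightarrow> nat set \<Rightarrow> qvec set" where
  "hspace d I = {v. \<forall>x. x \<notin> multi_idx d I \<longrightarrow> v x = 0}"

definition braket :: "(nat \<Rightarrow> nat) \<Rightarrow> nat set \<Rightarrow> qvec \<Rightarrow> qvec \<Rightarrow> complex" where
  "braket d I u v = (\<Sum>x\<in>multi_idx d I. cnj (u x) * v x)"

definition pure_state :: "(nat \<Rightarrow> nat) \<Rightarrow> nat set \<Rightarrow> qvec \<Rightarrow> bool" where
  "pure_state d I v \<longleftrightarrow> v \<in> hspace d I \<and> braket d I v v = 1"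

definition orthonormal_family ::
    "(nat \<Rightarrow> nat) \<Rightarrow> nat set \<Rightarrow> nat set \<Rightarrow> (nat \<Rightarrow> qvec) \<Rightarrow> bool" where
  "orthonormal_family d I N v \<longleftrightarrow>
     (\<forall>i\<in>N. v i \<in> hspace d I) \<and>
     (\<forall>i\<in>N. \<forall>j\<in>N. braket d I (v i) (v j) = (if i = j then 1 else 0))"

definition tensor :: "(nat \<Rightarrow> nat) \<Rightarrow> nat set \<Rightarrow> nat set \<Rightarrow> qvec \<Rightarrow> qvec \<Rightarrow> qvec" where
  "tensor d I J u v =
     (\<lambda>x. if x \<in> multi_idx d (I \<union> J) then u (restrict x I) * v (restrict x J) else 0)"

(* |u><v| *)
definition outer :: "qvec \<Rightarrow> qvec \<Rightarrow> qop" where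
  "outer u v = (\<lambda>x y. u x * cnj (v y))"

definition op_apply :: "(nat \<Rightarrow> nat) \<Rightarrow> nat set \<Rightarrow> qop \<Rightarrow> qvec \<Rightarrow> qvec" where
  "op_apply d I A v =
     (\<lambda>x. if x \<in> multi_idx d I then (\<Sum>y\<in>multi_idx d I. A x y * v y) else 0)"

(* Partial trace over the parties in J of an operator A on the parties in I; the result is an
   operator on the parties in I - J. *)
definition partial_trace :: "(nat \<Rightarrow> nat) \<Rightarrow> nat set \<Rightarrow> nat set \<Rightarrow> qop \<Rightarrow> qop" where
  "partial_trace d I J A =
     (\<lambda>x y. if x \<in> multi_idx d (I - J) \<and> y \<in> multi_idx d (I - J)
            then (\<Sum>z\<in>multi_idx d J. A (merge (I - J) J (x, z)) (merge (I - J) J (y, z)))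
            else 0)"

definition reduced_state :: "(nat \<Rightarrow> nat) \<Rightarrow> nat set \<Rightarrow> nat \<Rightarrow> qvec \<Rightarrow> qop" where
  "reduced_state d I j v = partial_trace d I (I - {j}) (outer v v)"

(* The support of an operator is the orthogonal complement of its kernel. *)
definition op_support :: "(nat \<Rightarrow> nat) \<Rightarrow> nat set \<Rightarrow> qop \<Rightarrow> qvec set" where
  "op_support d I A =
     {u \<in> hspace d I. \<forall>v\<in>hspace d I. op_apply d I A v = (\<lambda>_. 0) \<longrightarrow> braket d I v u = 0}"

definition orthogonal_ops :: "(nat \<Rightarrow> nat) \<Rightarrow> nat set \<Rightarrow> qop \<Rightarrow> qop \<Rightarrow> bool" where
  "orthogonal_ops d I A B \<longleftrightarrow>
     (\<forall>u\<in>op_support d I A. \<forall>v\<in>op_support d I B. braket d I u v = 0)"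

definition same_marginals :: "(nat \<Rightarrow> nat) \<Rightarrow> nat \<Rightarrow> qvec \<Rightarrow> qvec set" where
  "same_marginals d n psi =
     {phi. pure_state d {1..n} phi \<and>
        (\<forall>i\<in>{1..n}. partial_trace d {1..n} {i} (outer psi psi)
                    = partial_trace d {1..n} {i} (outer phi phi))}"

definition locally_undetermined :: "(nat \<Rightarrow> nat) \<Rightarrow> nat \<Rightarrow> qvec \<Rightarrow> bool" where
  "locally_undetermined d n psi \<longleftrightarrow>
     (\<exists>phi\<in>same_marginals d n psi. cmod (braket d {1..n} phi psi) \<noteq> 1)"

definition schmidt_term ::
    "(nat \<Rightarrow> nat) \<Rightarrow> nat \<Rightarrow> nat \<Rightarrow> (nat \<Rightarrow> real) \<Rightarrow> (nat \<Rightarrow> qvec) \<Rightarrow> (nat \<Rightarrow> qvec) \<Rightarrow> nat \<Rightarrow> qvec" where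
  "schmidt_term d n k lam e f i =
     (\<lambda>x. complex_of_real (sqrt (lam i)) * tensor d {k} ({1..n} - {k}) (e i) (f i) x)"

definition schmidt_decomposition ::
    "(nat \<Rightarrow> nat) \<Rightarrow> nat \<Rightarrow> nat \<Rightarrow> qvec \<Rightarrow>
     nat \<Rightarrow> (nat \<Rightarrow> real) \<Rightarrow> (nat \<Rightarrow> qvec) \<Rightarrow> (nat \<Rightarrow> qvec) \<Rightarrow> bool" where
  "schmidt_decomposition d n k psi M lam e f \<longleftrightarrow>
     (\<forall>i\<in>{1..M}. 0 < lam i) \<and>
     orthonormal_family d {k} {1..M} e \<and>
     orthonormal_family d ({1..n} - {k}) {1..M} f \<and>
     psi = (\<lambda>x. \<Sum>i=1..M. schmidt_term d n k lam e f i x)"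

definition complete_partition :: "nat set \<Rightarrow> nat \<Rightarrow> (nat \<Rightarrow> nat set) \<Rightarrow> bool" where
  "complete_partition X L S \<longleftrightarrow>
     (\<forall>l\<in>{1..L}. S l \<noteq> {}) \<and> disjoint_family_on S {1..L} \<and> (\<Union>l\<in>{1..L}. S l) = X"

(* Complete partitions S_1, ..., S_L, L >= 2, of {1..M} such that Schmidt vectors on the
   complement of k with indices in different blocks have orthogonal one-party reduced states. *)
definition locally_orthogonal_partition ::
    "(nat \<Rightarrow> nat) \<Rightarrow> nat \<Rightarrow> nat \<Rightarrow> nat \<Rightarrow> (nat \<Rightarrow> qvec) \<Rightarrow> nat \<Rightarrow> (nat \<Rightarrow> nat set) \<Rightarrow> bool" where
  "locally_orthogonal_partition d n k M f L S \<longleftrightarrow>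
     2 \<le> L \<and> complete_partition {1..M} L S \<and>
     (\<forall>j\<in>{1..n} - {k}. \<forall>l\<in>{1..L}. \<forall>l'\<in>{1..L}. l \<noteq> l' \<longrightarrow>
        (\<forall>r\<in>S l. \<forall>t\<in>S l'.
           orthogonal_ops d {j} (reduced_state d ({1..n} - {k}) j (f r))
                                (reduced_state d ({1..n} - {k}) j (f t))))"

(* All states obtained from one fixed Schmidt decomposition; the partition and phases vary.
   Pitfall: for n = 2 with a repeated Schmidt coefficient, no single decomposition yields all of
   same_marginals.  For the Bell state that set is {(U (x) 1) psi | U unitary}, while a fixed
   decomposition only gives the U that are diagonal in its basis. *)
definition block_phase_states ::
    "(nat \<Rightarrow> nat) \<Rightarrow> nat \<Rightarrow> nat \<Rightarrow>
     nat \<Rightarrow> (nat \<Rightarrow> real) \<Rightarrow> (nat \<Rightarrow> qvec) \<Rightarrow> (nat \<Rightarrow> qvec) \<Rightarrow> qvec set" where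
  "block_phase_states d n k M lam e f =
     {(\<lambda>x. \<Sum>j=1..L. exp (\<i> * complex_of_real (theta j)) *
                     (\<Sum>i\<in>S j. schmidt_term d n k lam e f i x)) | L S theta.
        locally_orthogonal_partition d n k M f L S \<and>
        (\<forall>j\<in>{1..L}. 0 \<le> theta j \<and> theta j < 2 * pi)}"

end

theory Submission
  imports Defs "HOL-Computational_Algebra.Fundamental_Theorem_Algebra"
begin

text \<open>
  View \<open>psi\<close> and \<open>phi\<close>, a state with the same marginals, as matrices \<open>A\<close> and \<open>B\<close> whose rows
  belong to party \<open>k\<close>. Then \<open>A\<^sup>* A = B\<^sup>* B\<close> (up to conjugation, tracing out \<open>k\<close>) and \<open>A A\<^sup>* = B B\<^sup>*\<close> (the
  reduced state on \<open>k\<close>), so \<open>T = B A\<^sup>*\<close> is normal and commutes with \<open>A A\<^sup>*\<close>. A common orthonormal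
  eigenbasis yields a Schmidt decomposition of \<open>psi\<close> in which \<open>phi\<close> differs from \<open>psi\<close> only by phases
  of the Schmidt terms. Comparing the marginals over the remaining parties, terms with different phases
  must have orthogonal one-party reductions; grouping equal phases gives the partition, and conversely
  any phases that are constant on such blocks preserve all marginals. For at least three parties the
  operators \<open>T\<close> of all such \<open>phi\<close> commute, because the local operators producing the states can be
  moved to different parties; for simple Schmidt coefficients every \<open>T\<close> is diagonal in
  the given Schmidt basis. Hence in these cases one decomposition serves all \<open>phi\<close>.
\<close>

section \<open>Simultaneous diagonalization of commuting normal matrices\<close>

text \<open>Both properties of \<open>T\<close> come from cycling the equal products. With
  \<open>rho = A A^* = B B^*\<close> one has
  \<open>T T^* = B (A^* A) B^* = B (B^* B) B^* = rho^2\<close> and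
  \<open>T^* T = A (B^* B) A^* = A (A^* A) A^* = rho^2\<close>, while
  \<open>T rho = B (A^* A) A^* = B (B^* B) A^* = rho T\<close>. When \<open>rho\<close> has repeated
  eigenvalues its eigenbasis is not unique; the freedom is spent on diagonalising \<open>T\<close>
  as well, so the Schmidt decomposition is adapted to \<open>phi\<close>.

  Two obstacles shape the argument. With two parties and repeated coefficients, different
  \<open>phi\<close> may call for different eigenbases, so one description of the set of states lets
  the decomposition vary. Moreover, a multiple of \<open>psi\<close> has constant weights and yields
  no partition into at least two blocks; it borrows the partition produced by a state
  \<open>phi0\<close> whose overlap with \<open>psi\<close> does not have modulus 1.\<close>

definition cdot :: "nat \<Rightarrow> (nat \<Rightarrow> complex) \<Rightarrow> (nat \<Rightarrow> complex) \<Rightarrow> complex" where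
  "cdot D u v = (\<Sum>a<D. cnj (u a) * v a)"

definition mvec :: "nat \<Rightarrow> (nat \<Rightarrow> nat \<Rightarrow> complex) \<Rightarrow> (nat \<Rightarrow> complex) \<Rightarrow> nat \<Rightarrow> complex" where
  "mvec D A v = (\<lambda>a. \<Sum>b<D. A a b * v b)"

definition mmult ::
    "nat \<Rightarrow> (nat \<Rightarrow> nat \<Rightarrow> complex) \<Rightarrow> (nat \<Rightarrow> nat \<Rightarrow> complex) \<Rightarrow> nat \<Rightarrow> nat \<Rightarrow> complex" where
  "mmult D A B = (\<lambda>a b. \<Sum>c<D. A a c * B c b)"

definition adj :: "(nat \<Rightarrow> nat \<Rightarrow> complex) \<Rightarrow> nat \<Rightarrow> nat \<Rightarrow> complex" where
  "adj A = (\<lambda>a b. cnj (A b a))"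

lemma mvec_mmult: "mvec D (mmult D A B) v = mvec D A (mvec D B v)"
proof
  fix a
  have "mvec D (mmult D A B) v a = (\<Sum>b<D. \<Sum>c<D. A a c * B c b * v b)"
    by (simp add: mvec_def mmult_def sum_distrib_right)
  also have "\<dots> = (\<Sum>c<D. \<Sum>b<D. A a c * B c b * v b)"
    by (rule sum.swap)
  also have "\<dots> = mvec D A (mvec D B v) a"
    by (simp add: mvec_def sum_distrib_left mult.assoc)
  finally show "mvec D (mmult D A B) v a = mvec D A (mvec D B v) a" .
qed

lemma mmult_assoc: "mmult D (mmult D A B) C = mmult D A (mmult D B C)"
proof (intro ext)
  fix a b
  show "mmult D (mmult D A B) C a b = mmult D A (mmult D B C) a b"
    using fun_cong[OF mvec_mmult[of D A B "\<lambda>c. C c b"], of a]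
    by (simp add: mvec_def mmult_def)
qed

lemma mvec_add: "mvec D A (\<lambda>a. u a + v a) = (\<lambda>a. mvec D A u a + mvec D A v a)"
  by (simp add: mvec_def algebra_simps sum.distrib)

lemma mvec_scale: "mvec D A (\<lambda>a. c * v a) = (\<lambda>a. c * mvec D A v a)"
  by (simp add: mvec_def algebra_simps sum_distrib_left)

lemma mvec_zero: "mvec D A (\<lambda>a. 0) = (\<lambda>a. 0)"
  by (simp add: mvec_def)

lemma cdot_adj: "cdot D u (mvec D A v) = cdot D (mvec D (adj A) u) v"
proof -
  have "cdot D u (mvec D A v) = (\<Sum>a<D. \<Sum>b<D. cnj (u a) * (A a b * v b))"
    by (simp add: cdot_def mvec_def sum_distrib_left)
  also have "\<dots> = (\<Sum>b<D. \<Sum>a<D. cnj (u a) * (A a b * v b))"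
    by (rule sum.swap)
  also have "\<dots> = cdot D (mvec D (adj A) u) v"
    by (simp add: cdot_def mvec_def adj_def sum_distrib_left mult_ac)
  finally show ?thesis .
qed

lemma cdot_scale_right: "cdot D u (\<lambda>a. c * v a) = c * cdot D u v"
  by (simp add: cdot_def sum_distrib_left mult_ac)

lemma cdot_scale_left: "cdot D (\<lambda>a. c * u a) v = cnj c * cdot D u v"
  by (simp add: cdot_def sum_distrib_left mult_ac)

lemma cdot_diff_right: "cdot D u (\<lambda>a. v a - w a) = cdot D u v - cdot D u w"
  by (simp add: cdot_def algebra_simps sum_subtractf)

lemma cdot_add_right: "cdot D u (\<lambda>a. v a + w a) = cdot D u v + cdot D u w"
  by (simp add: cdot_def algebra_simps sum.distrib)

lemma cdot_diff_left: "cdot D (\<lambda>a. v a - w a) u = cdot D v u - cdot D w u"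
  by (simp add: cdot_def algebra_simps sum_subtractf)

lemma cdot_sum_right: "cdot D u (\<lambda>a. \<Sum>i\<in>I. v i a) = (\<Sum>i\<in>I. cdot D u (v i))"
  unfolding cdot_def sum_distrib_left by (rule sum.swap)

lemma cdot_commute: "cdot D u v = cnj (cdot D v u)"
  by (simp add: cdot_def mult.commute)

lemma sum_cnj_mult: "(\<Sum>x\<in>X. cnj (u x) * u x) = complex_of_real (\<Sum>x\<in>X. (cmod (u x))\<^sup>2)"
  by (simp only: complex_norm_square of_real_sum mult.commute)

lemma sum_cnj_mult_eq_0_iff:
  assumes "finite X"
  shows "(\<Sum>x\<in>X. cnj (u x) * u x) = 0 \<longleftrightarrow> (\<forall>x\<in>X. u x = 0)"
  unfolding sum_cnj_mult using assms by (simp add: sum_nonneg_eq_0_iff del: of_real_sum)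

lemma cdot_self: "cdot D u u = complex_of_real (\<Sum>a<D. (cmod (u a))\<^sup>2)"
  unfolding cdot_def by (rule sum_cnj_mult)

lemma cdot_self_eq_0_iff: "cdot D u u = 0 \<longleftrightarrow> (\<forall>a<D. u a = 0)"
  unfolding cdot_def by (subst sum_cnj_mult_eq_0_iff) auto

text \<open>Elimination of one coordinate per step: a vector with nonzero coordinate
  \<open>D\<close> is the pivot that clears this coordinate from the others. An indexed family,
  rather than a set, allows repetitions such as coinciding iterates of a matrix.\<close>

lemma exists_nontrivial_combination:
  fixes v :: "'i \<Rightarrow> nat \<Rightarrow> complex"
  assumes "finite I" "D < card I"
  shows "\<exists>p. (\<exists>i\<in>I. p i \<noteq> 0) \<and> (\<forall>a<D. (\<Sum>i\<in>I. p i * v i a) = 0)"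
  using assms
proof (induction D arbitrary: I v)
  case 0
  then have "I \<noteq> {}" by auto
  then show ?case by (intro exI[of _ "\<lambda>_. 1"]) auto
next
  case (Suc D)
  show ?case
  proof (cases "\<forall>i\<in>I. v i D = 0")
    case True
    obtain p where "\<exists>i\<in>I. p i \<noteq> 0" "\<forall>a<D. (\<Sum>i\<in>I. p i * v i a) = 0"
      using Suc.IH[of I v] Suc.prems by auto
    with True show ?thesis by (intro exI[of _ p]) (auto simp: less_Suc_eq)
  next
    case False
    then obtain i0 where i0: "i0 \<in> I" "v i0 D \<noteq> 0" by auto
    define J where "J = I - {i0}"
    have J: "finite J" "D < card J" using Suc.prems i0 by (auto simp: J_def)
    define v' where "v' i = (\<lambda>a. v i a - v i D / v i0 D * v i0 a)" for i
    obtain p where p: "\<exists>i\<in>J. p i \<noteq> 0" "\<forall>a<D. (\<Sum>i\<in>J. p i * v' i a) = 0"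
      using Suc.IH[OF J, of v'] by auto
    \<comment> \<open>The coefficient of the pivot collects what was subtracted in passing from
      \<open>v\<close> to \<open>v'\<close>, so both combinations agree in every coordinate.\<close>
    define q where "q = p(i0 := - (\<Sum>i\<in>J. p i * (v i D / v i0 D)))"
    have "(\<Sum>i\<in>I. q i * v i a) = (\<Sum>i\<in>J. p i * v' i a)" for a
    proof -
      have "(\<Sum>i\<in>I. q i * v i a) = q i0 * v i0 a + (\<Sum>i\<in>J. q i * v i a)"
        unfolding J_def using Suc.prems i0 by (subst sum.remove[of _ i0]) auto
      also have "(\<Sum>i\<in>J. q i * v i a) = (\<Sum>i\<in>J. p i * v i a)"
        by (rule sum.cong) (auto simp: q_def J_def)
      finally show ?thesis
        by (simp add: q_def v'_def algebra_simps sum_subtractf sum_distrib_left sum_distrib_right)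
    qed
    moreover have "(\<Sum>i\<in>J. p i * v' i D) = 0"
      using i0 by (simp add: v'_def)
    ultimately have "\<forall>a<Suc D. (\<Sum>i\<in>I. q i * v i a) = 0"
      using p(2) by (auto simp: less_Suc_eq)
    moreover have "\<exists>i\<in>I. q i \<noteq> 0" using p(1) by (auto simp: q_def J_def)
    ultimately show ?thesis by blast
  qed
qed

text \<open>Vectors of C^D are functions on all naturals that vanish from \<open>D\<close> on, so
  that a vector is zero exactly when it is the constant function 0.\<close>

definition supported_subspace :: "nat \<Rightarrow> (nat \<Rightarrow> complex) set \<Rightarrow> bool" where
  "supported_subspace D W \<longleftrightarrow> (\<forall>v\<in>W. \<forall>a\<ge>D. v a = 0) \<and> (\<lambda>_. 0) \<in> W \<and>
     (\<forall>u\<in>W. \<forall>v\<in>W. (\<lambda>a. u a + v a) \<in> W) \<and> (\<forall>c. \<forall>v\<in>W. (\<lambda>a. c * v a) \<in> W)"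

lemma supported_subspace_add: "supported_subspace D W \<Longrightarrow> u \<in> W \<Longrightarrow> v \<in> W \<Longrightarrow> (\<lambda>a. u a + v a) \<in> W"
  by (simp add: supported_subspace_def)

lemma supported_subspace_scale: "supported_subspace D W \<Longrightarrow> v \<in> W \<Longrightarrow> (\<lambda>a. c * v a) \<in> W"
  by (simp add: supported_subspace_def)

lemma supported_subspace_diff: "supported_subspace D W \<Longrightarrow> u \<in> W \<Longrightarrow> v \<in> W \<Longrightarrow> (\<lambda>a. u a - v a) \<in> W"
  using supported_subspace_add[of D W u "\<lambda>a. (-1) * v a"] supported_subspace_scale[of D W v "-1"] by simp

lemma supported_subspace_sum:
  assumes "supported_subspace D W" "finite I" "\<And>i. i \<in> I \<Longrightarrow> v i \<in> W"
  shows "(\<lambda>a. \<Sum>i\<in>I. c i * v i a) \<in> W"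
  using assms(2,3)
proof (induction I rule: finite_induct)
  case empty
  then show ?case using assms(1) by (simp add: supported_subspace_def)
next
  case (insert i I)
  then have "(\<lambda>a. c i * v i a) \<in> W" "(\<lambda>a. \<Sum>i\<in>I. c i * v i a) \<in> W"
    using assms(1) by (auto simp: supported_subspace_def)
  then have "(\<lambda>a. c i * v i a + (\<Sum>i\<in>I. c i * v i a)) \<in> W"
    by (rule supported_subspace_add[OF assms(1)])
  then show ?case using insert by simp
qed

text \<open>Induction on the degree. Split off a root \<open>c\<close> of \<open>p\<close>: either
  \<open>w\<close> is already an eigenvector for \<open>c\<close>, or \<open>(A - c) w\<close> is a
  nonzero vector of \<open>W\<close> annihilated by the quotient.\<close>

lemma eigenvector_of_annihilator:
  assumes W: "supported_subspace D W" and inv: "\<And>v. v \<in> W \<Longrightarrow> mvec D A v \<in> W"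
    and "w \<in> W" "w \<noteq> (\<lambda>_. 0)" "p \<noteq> 0"
    and "\<And>a. (\<Sum>i\<le>degree p. coeff p i * (mvec D A ^^ i) w a) = 0"
  shows "\<exists>c. \<exists>v\<in>W. v \<noteq> (\<lambda>_. 0) \<and> mvec D A v = (\<lambda>a. c * v a)"
  using assms(3-)
proof (induction "degree p" arbitrary: p w)
  case 0
  then obtain c where p: "p = [:c:]" by (metis degree_eq_zeroE)
  then have "c \<noteq> 0" using 0 by auto
  moreover have "c * w a = 0" for a using "0.prems"(4)[of a] p by simp
  ultimately show ?case using 0 by auto
next
  case (Suc N)
  have "\<not> constant (poly p)"
    using Suc.hyps(2) by (simp add: constant_degree)
  then obtain c where "poly p c = 0"
    using fundamental_theorem_of_algebra by blast
  then obtain q where pq: "p = [:-c, 1:] * q"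
    by (auto simp: poly_eq_0_iff_dvd dvd_def)
  have "q \<noteq> 0" using Suc.prems pq by auto
  then have dp: "degree p = Suc (degree q)"
    unfolding pq by (subst degree_mult_eq) auto
  define w' where "w' = (\<lambda>a. mvec D A w a - c * w a)"
  show ?case
  proof (cases "w' = (\<lambda>_. 0)")
    case True
    then have "mvec D A w = (\<lambda>a. c * w a)" by (auto simp: w'_def fun_eq_iff)
    then show ?thesis using Suc.prems by blast
  next
    case False
    have w': "w' \<in> W"
      unfolding w'_def using inv Suc.prems W by (intro supported_subspace_diff[OF W]) (auto simp: supported_subspace_def)
    have pow: "(mvec D A ^^ i) w' = (\<lambda>a. (mvec D A ^^ Suc i) w a - c * (mvec D A ^^ i) w a)" for i
    proof (induction i)
      case 0
      then show ?case by (simp add: w'_def)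
    next
      case (Suc i)
      have "(mvec D A ^^ Suc i) w' = mvec D A (\<lambda>a. (mvec D A ^^ Suc i) w a - c * (mvec D A ^^ i) w a)"
        by (simp only: funpow.simps o_apply Suc.IH)
      also have "\<dots> = (\<lambda>a. mvec D A ((mvec D A ^^ Suc i) w) a - c * mvec D A ((mvec D A ^^ i) w) a)"
        by (simp add: mvec_def algebra_simps sum_subtractf sum_distrib_left)
      finally show ?case by simp
    qed
    have "(\<Sum>i\<le>degree q. coeff q i * (mvec D A ^^ i) w' a) = 0" for a
    proof -
      define g where "g i = (mvec D A ^^ i) w a" for i
      have cp: "coeff p i = coeff (pCons 0 q) i - c * coeff q i" for i
        unfolding pq by simp
      have "0 = (\<Sum>i\<le>Suc (degree q). coeff p i * g i)"
        using Suc.prems(4)[of a] dp by (simp add: g_def)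
      also have "\<dots> = (\<Sum>i\<le>Suc (degree q). coeff (pCons 0 q) i * g i) - c * (\<Sum>i\<le>Suc (degree q). coeff q i * g i)"
        unfolding cp by (simp only: sum_distrib_left left_diff_distrib sum_subtractf mult.assoc)
      also have "(\<Sum>i\<le>Suc (degree q). coeff (pCons 0 q) i * g i) = (\<Sum>i\<le>degree q. coeff q i * g (Suc i))"
        by (subst sum.atMost_Suc_shift) simp
      also have "(\<Sum>i\<le>Suc (degree q). coeff q i * g i) = (\<Sum>i\<le>degree q. coeff q i * g i)"
        by (simp add: coeff_eq_0)
      finally have "(\<Sum>i\<le>degree q. coeff q i * (g (Suc i) - c * g i)) = 0"
        by (simp add: algebra_simps sum_subtractf sum_distrib_left)
      then show ?thesis unfolding pow g_def .
    qed
    then show ?thesis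
      using Suc.hyps(1)[of q w'] Suc.hyps(2) dp w' False \<open>q \<noteq> 0\<close> by auto
  qed
qed

text \<open>The \<open>D + 1\<close> vectors \<open>w\<close>, \<open>A w\<close>, ...,
  \<open>A^D w\<close> are linearly dependent, and a dependency is an annihilating
  polynomial.\<close>

lemma eigenvector_exists:
  assumes W: "supported_subspace D W" and inv: "\<And>v. v \<in> W \<Longrightarrow> mvec D A v \<in> W"
    and w: "w \<in> W" "w \<noteq> (\<lambda>_. 0)"
  shows "\<exists>c. \<exists>v\<in>W. v \<noteq> (\<lambda>_. 0) \<and> mvec D A v = (\<lambda>a. c * v a)"
proof -
  obtain s where s: "\<exists>i\<in>{..D}. s i \<noteq> 0" "\<forall>a<D. (\<Sum>i\<in>{..D}. s i * (mvec D A ^^ i) w a) = 0"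
    using exists_nontrivial_combination[of "{..D}" D "\<lambda>i. (mvec D A ^^ i) w"] by auto
  have mem: "(mvec D A ^^ i) w \<in> W" for i
    by (induction i) (use w inv in auto)
  define p where "p = Poly (map s [0..<Suc D])"
  have cp: "coeff p i = (if i \<le> D then s i else 0)" for i
    by (auto simp: p_def coeff_Poly_eq nth_default_def simp del: upt_Suc)
  have "p \<noteq> 0" using s(1) cp by (metis atMost_iff coeff_0)
  moreover have "(\<Sum>i\<le>degree p. coeff p i * (mvec D A ^^ i) w a) = 0" for a
  proof -
    have "degree p \<le> D" by (rule degree_le) (simp add: cp)
    then have "(\<Sum>i\<le>degree p. coeff p i * (mvec D A ^^ i) w a) = (\<Sum>i\<le>D. coeff p i * (mvec D A ^^ i) w a)"
      by (intro sum.mono_neutral_left) (auto simp: coeff_eq_0)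
    also have "\<dots> = (\<Sum>i\<le>D. s i * (mvec D A ^^ i) w a)" by (simp add: cp)
    also have "\<dots> = 0"
    \<comment> \<open>The dependency covers only coordinates below \<open>D\<close>; the others
      vanish because every iterate lies in \<open>W\<close>.\<close>
    proof (cases "a < D")
      case False
      then have "(mvec D A ^^ i) w a = 0" for i using W mem[of i] by (auto simp: supported_subspace_def)
      then show ?thesis by simp
    qed (use s in auto)
    finally show ?thesis .
  qed
  ultimately show ?thesis
    using eigenvector_of_annihilator[OF W inv w] by blast
qed

definition orthonormal_in :: "nat \<Rightarrow> (nat \<Rightarrow> complex) set \<Rightarrow> nat \<Rightarrow> (nat \<Rightarrow> nat \<Rightarrow> complex) \<Rightarrow> bool" where
  "orthonormal_in D W m v \<longleftrightarrow> (\<forall>i<m. v i \<in> W) \<and> (\<forall>i<m. \<forall>j<m. cdot D (v i) (v j) = (if i = j then 1 else 0))"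

lemma orthonormal_in_le:
  assumes "orthonormal_in D W m v"
  shows "m \<le> D"
proof (rule ccontr)
  assume "\<not> m \<le> D"
  then obtain p where p: "\<exists>i<m. p i \<noteq> 0" "\<forall>a<D. (\<Sum>i<m. p i * v i a) = 0"
    using exists_nontrivial_combination[of "{..<m}" D v] by auto
  then obtain j where j: "j < m" "p j \<noteq> 0" by auto
  have "0 = cdot D (v j) (\<lambda>a. \<Sum>i<m. p i * v i a)"
    using p(2) by (simp add: cdot_def)
  also have "\<dots> = (\<Sum>i<m. p i * cdot D (v j) (v i))"
    by (simp add: cdot_sum_right cdot_scale_right)
  also have "\<dots> = (\<Sum>i<m. if i = j then p i else 0)"
    using assms j by (intro sum.cong) (auto simp: orthonormal_in_def)
  also have "\<dots> = p j" using j by simp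
  finally show False using j by simp
qed

text \<open>Of \<open>W\<close> only the multiples of \<open>x\<close> matter, because
  \<open>W\<close> will also be the set of common eigenvectors of a family of matrices, which in
  general is not closed under addition.\<close>

lemma orthonormal_in_extend:
  assumes v: "orthonormal_in D W m v" and x: "x \<noteq> (\<lambda>_. 0)" "\<And>a. a \<ge> D \<Longrightarrow> x a = 0"
    and orth: "\<And>i. i < m \<Longrightarrow> cdot D (v i) x = 0"
    and W: "\<And>c. (\<lambda>a. c * x a) \<in> W"
  shows "\<exists>v'. orthonormal_in D W (Suc m) v'"
proof -
  define r where "r = (\<Sum>a<D. (cmod (x a))\<^sup>2)"
  have xx: "cdot D x x = of_real r" by (simp add: cdot_self r_def)
  have "cdot D x x \<noteq> 0" unfolding cdot_self_eq_0_iff using x by (metis ext not_less)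
  moreover have "r \<ge> 0" unfolding r_def by (intro sum_nonneg) auto
  ultimately have r: "r > 0" using xx by (auto simp: less_le)
  define y where "y = (\<lambda>a. of_real (1 / sqrt r) * x a)"
  have "cdot D y y = of_real (1 / sqrt r) * of_real (1 / sqrt r) * of_real r"
    unfolding y_def cdot_scale_left cdot_scale_right xx complex_cnj_complex_of_real
    by (simp only: mult.assoc)
  also have "\<dots> = of_real (1 / sqrt r * (1 / sqrt r) * r)" by (simp only: of_real_mult)
  also have "1 / sqrt r * (1 / sqrt r) * r = 1" using r by simp
  finally have yy: "cdot D y y = 1" by simp
  have vy: "cdot D (v i) y = 0" if "i < m" for i
    unfolding y_def cdot_scale_right using orth[OF that] by simp
  have yv: "cdot D y (v i) = 0" if "i < m" for i
    using cdot_commute[of D y "v i"] vy[OF that] by simp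
  have "orthonormal_in D W (Suc m) (v(m := y))"
    unfolding orthonormal_in_def
  proof (intro conjI allI impI)
    fix i assume "i < Suc m"
    then show "(v(m := y)) i \<in> W"
      using v W[of "of_real (1 / sqrt r)"] by (auto simp: orthonormal_in_def y_def less_Suc_eq simp del: of_real_divide)
  next
    fix i j assume "i < Suc m" "j < Suc m"
    then show "cdot D ((v(m := y)) i) ((v(m := y)) j) = (if i = j then 1 else 0)"
      using v yy vy yv by (auto simp: orthonormal_in_def less_Suc_eq)
  qed
  then show ?thesis by blast
qed

lemma orthonormal_in_remainder:
  assumes v: "orthonormal_in D W m v" and "j < m"
  shows "cdot D (v j) (\<lambda>a. x a - (\<Sum>i<m. cdot D (v i) x * v i a)) = 0"
proof -
  have "cdot D (v j) (\<lambda>a. \<Sum>i<m. cdot D (v i) x * v i a) = (\<Sum>i<m. cdot D (v i) x * cdot D (v j) (v i))"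
    by (simp add: cdot_sum_right cdot_scale_right)
  also have "\<dots> = (\<Sum>i<m. if i = j then cdot D (v i) x else 0)"
    using assms by (intro sum.cong) (auto simp: orthonormal_in_def)
  also have "\<dots> = cdot D (v j) x" using assms by simp
  finally show ?thesis by (simp add: cdot_diff_right)
qed

lemma maximal_size:
  assumes "P 0" "\<And>m. P m \<Longrightarrow> m \<le> (D::nat)"
  obtains m where "P m" "\<not> P (Suc m)"
proof -
  have bound: "\<forall>m. P m \<longrightarrow> m \<le> D" using assms(2) by blast
  have "P (Greatest P)" by (rule GreatestI_nat[of P 0 D]) (use assms(1) bound in auto)
  moreover have "\<not> P (Suc (Greatest P))"
  proof
    assume "P (Suc (Greatest P))"
    then have "Suc (Greatest P) \<le> Greatest P"
      by (rule Greatest_le_nat[of P _ D]) (use bound in auto)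
    then show False by simp
  qed
  ultimately show ?thesis using that by blast
qed

text \<open>On a subspace this is the dimension; \<open>orthonormal_in_le\<close> bounds the sizes,
  so the maximum exists. It is the measure for choosing a minimal invariant subspace.\<close>

definition orthonormal_dim :: "nat \<Rightarrow> (nat \<Rightarrow> complex) set \<Rightarrow> nat" where
  "orthonormal_dim D W = Greatest (\<lambda>m. \<exists>v. orthonormal_in D W m v)"

text \<open>A vector of \<open>W\<close> outside \<open>U\<close>, minus its projection onto a
  maximal orthonormal family of \<open>U\<close>, is nonzero and enlarges that family inside
  \<open>W\<close>.\<close>

lemma orthonormal_dim_psubset:
  assumes W: "supported_subspace D W" and U: "supported_subspace D U" "U \<subset> W"
  shows "orthonormal_dim D U < orthonormal_dim D W"
proof -
  have "\<exists>v. orthonormal_in D U (orthonormal_dim D U) v"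
    unfolding orthonormal_dim_def
    by (rule GreatestI_nat[where k = 0 and b = D]) (simp add: orthonormal_in_def, blast dest: orthonormal_in_le)
  then obtain v where v: "orthonormal_in D U (orthonormal_dim D U) v" by blast
  obtain x where x: "x \<in> W" "x \<notin> U" using U by auto
  have vW: "orthonormal_in D W (orthonormal_dim D U) v" using v U(2) by (auto simp: orthonormal_in_def)
  define y where "y = (\<lambda>a. x a - (\<Sum>i<orthonormal_dim D U. cdot D (v i) x * v i a))"
  have "(\<lambda>a. \<Sum>i<orthonormal_dim D U. cdot D (v i) x * v i a) \<in> U"
    using v by (intro supported_subspace_sum[OF U(1)]) (auto simp: orthonormal_in_def)
  note s = this
  have yW: "y \<in> W"
    unfolding y_def using s x U by (intro supported_subspace_diff[OF W]) auto
  have "y \<noteq> (\<lambda>_. 0)"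
  proof
    assume "y = (\<lambda>_. 0)"
    then have "x = (\<lambda>a. \<Sum>i<orthonormal_dim D U. cdot D (v i) x * v i a)"
      by (auto simp: y_def fun_eq_iff)
    with s x show False by metis
  qed
  moreover have "cdot D (v i) y = 0" if "i < orthonormal_dim D U" for i
    unfolding y_def by (rule orthonormal_in_remainder[OF v that])
  ultimately have "\<exists>v'. orthonormal_in D W (Suc (orthonormal_dim D U)) v'"
    using W yW \<open>y \<noteq> (\<lambda>_. 0)\<close> by (intro orthonormal_in_extend[OF vW, of y]) (auto simp: supported_subspace_def)
  then have "Suc (orthonormal_dim D U) \<le> orthonormal_dim D W"
    unfolding orthonormal_dim_def[of D W] by (intro Greatest_le_nat[where b = D]) (auto dest: orthonormal_in_le)
  then show ?thesis by simp
qed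

text \<open>A nonzero invariant subspace \<open>U\<close> of least dimension works: each
  \<open>A\<close> has an eigenspace inside \<open>U\<close>, commutation makes it invariant under
  all of \<open>F\<close>, and minimality forces it to be \<open>U\<close>. This also covers
  infinite \<open>F\<close>.\<close>

lemma common_eigenvector:
  assumes W: "supported_subspace D W" "w \<in> W" "w \<noteq> (\<lambda>_. 0)"
    and inv: "\<And>A v. A \<in> F \<Longrightarrow> v \<in> W \<Longrightarrow> mvec D A v \<in> W"
    and comm: "\<And>A B. A \<in> F \<Longrightarrow> B \<in> F \<Longrightarrow> mmult D A B = mmult D B A"
  shows "\<exists>v\<in>W. v \<noteq> (\<lambda>_. 0) \<and> (\<forall>A\<in>F. \<exists>c. mvec D A v = (\<lambda>a. c * v a))"
proof -
  define P where "P U \<longleftrightarrow> supported_subspace D U \<and> U \<subseteq> W \<and> U \<noteq> {\<lambda>_. 0} \<and> (\<forall>A\<in>F. \<forall>v\<in>U. mvec D A v \<in> U)" for U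
  have "P W" using assms by (auto simp: P_def)
  then obtain U where U: "P U" and least: "\<And>V. P V \<Longrightarrow> orthonormal_dim D U \<le> orthonormal_dim D V"
    using ex_has_least_nat[of P W "orthonormal_dim D"] by blast
  have subU: "supported_subspace D U" using U by (simp add: P_def)
  then have "(\<lambda>_. 0) \<in> U" by (simp add: supported_subspace_def)
  then obtain x where x: "x \<in> U" "x \<noteq> (\<lambda>_. 0)" using U by (auto simp: P_def)
  have "\<exists>c. mvec D A x = (\<lambda>a. c * x a)" if A: "A \<in> F" for A
  proof -
    have invA: "\<And>v. v \<in> U \<Longrightarrow> mvec D A v \<in> U" using U A by (auto simp: P_def)
    obtain c v where v: "v \<in> U" "v \<noteq> (\<lambda>_. 0)" "mvec D A v = (\<lambda>a. c * v a)"
      using eigenvector_exists[OF subU invA x] by blast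
    define V where "V = {v\<in>U. mvec D A v = (\<lambda>a. c * v a)}"
    have "supported_subspace D V"
      using subU by (auto simp: supported_subspace_def V_def mvec_add mvec_scale mvec_zero algebra_simps)
    moreover have "mvec D B u \<in> V" if "B \<in> F" "u \<in> V" for B u
    proof -
      have "mvec D A (mvec D B u) = mvec D B (mvec D A u)"
        using comm[OF A that(1)] by (metis mvec_mmult)
      also have "\<dots> = (\<lambda>a. c * mvec D B u a)" using that by (simp add: V_def mvec_scale)
      finally show ?thesis using that U by (auto simp: V_def P_def)
    qed
    moreover have "V \<noteq> {\<lambda>_. 0}" using v by (auto simp: V_def)
    moreover have VU: "V \<subseteq> U" by (auto simp: V_def)
    ultimately have "P V" using U by (auto simp: P_def)
    then have "V = U"
      using least[of V] orthonormal_dim_psubset[OF subU \<open>supported_subspace D V\<close>] VU by fastforce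
    then show ?thesis using x by (auto simp: V_def)
  qed
  then show ?thesis using U x by (auto simp: P_def)
qed

text \<open>Expanding the squared norm of \<open>adj A v - cnj c v\<close> gives 0, so
  \<open>v\<close> is an eigenvector of the adjoint. The conclusion is the form used later:
  \<open>A\<close> maps vectors orthogonal to \<open>v\<close> to vectors orthogonal to
  \<open>v\<close>.\<close>

lemma normal_eigenvector_adj:
  assumes normal: "mmult D A (adj A) = mmult D (adj A) A"
    and v: "mvec D A v = (\<lambda>a. c * v a)"
  shows "cdot D v (mvec D A w) = c * cdot D v w"
proof -
  let ?B = "mvec D (adj A)"
  define z where "z = (\<lambda>a. ?B v a - cnj c * v a)"
  have 1: "cdot D (?B v) v = c * cdot D v v"
    by (simp add: cdot_adj[symmetric] v cdot_scale_right)
  have 2: "cdot D v (?B v) = cnj c * cdot D v v"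
    by (subst cdot_commute, subst 1) (simp add: cdot_self del: of_real_sum)
  have "cdot D (?B v) (?B v) = cdot D v (mvec D A (?B v))"
    by (simp add: cdot_adj)
  also have "mvec D A (?B v) = ?B (mvec D A v)"
    using normal by (metis mvec_mmult)
  also have "cdot D v (?B (mvec D A v)) = cnj c * (c * cdot D v v)"
    by (simp add: v mvec_scale cdot_scale_right 2)
  finally have 3: "cdot D (?B v) (?B v) = cnj c * (c * cdot D v v)" .
  have "cdot D z z = 0"
    unfolding z_def cdot_diff_left cdot_diff_right cdot_scale_left cdot_scale_right 1 2 3
    by (simp add: algebra_simps)
  then have "\<forall>a<D. ?B v a = cnj c * v a"
    by (simp add: cdot_self_eq_0_iff z_def)
  then have "cdot D (?B v) w = cdot D (\<lambda>a. cnj c * v a) w"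
    by (simp add: cdot_def)
  then show ?thesis by (simp add: cdot_adj cdot_scale_left)
qed

text \<open>Take a maximal orthonormal family of common eigenvectors. Normality makes its orthogonal
  complement invariant, so a nonzero complement would contain one more common eigenvector.\<close>

lemma simultaneous_diagonalization:
  assumes supp: "\<And>A a b. A \<in> F \<Longrightarrow> D \<le> a \<Longrightarrow> A a b = 0"
    and comm: "\<And>A B. A \<in> F \<Longrightarrow> B \<in> F \<Longrightarrow> mmult D A B = mmult D B A"
    and normal: "\<And>A. A \<in> F \<Longrightarrow> mmult D A (adj A) = mmult D (adj A) A"
  shows "\<exists>m v. orthonormal_in D {v. \<forall>a\<ge>D. v a = 0} m v \<and>
    (\<forall>A\<in>F. \<forall>i<m. \<exists>c. mvec D A (v i) = (\<lambda>a. c * v i a)) \<and>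
    (\<forall>x. (\<forall>a\<ge>D. x a = 0) \<longrightarrow> x = (\<lambda>a. \<Sum>i<m. cdot D (v i) x * v i a))"
proof -
  define E where "E = {v. (\<forall>a\<ge>D. v a = 0) \<and> (\<forall>A\<in>F. \<exists>c. mvec D A v = (\<lambda>a. c * v a))}"
  have "\<exists>v. orthonormal_in D E 0 v" by (simp add: orthonormal_in_def)
  then obtain m where m: "\<exists>v. orthonormal_in D E m v" "\<not> (\<exists>v. orthonormal_in D E (Suc m) v)"
    by (rule maximal_size[of "\<lambda>m. \<exists>v. orthonormal_in D E m v" D]) (blast dest: orthonormal_in_le)
  then obtain v where v: "orthonormal_in D E m v" by blast
  define W where "W = {w. (\<forall>a\<ge>D. w a = 0) \<and> (\<forall>i<m. cdot D (v i) w = 0)}"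
  have subW: "supported_subspace D W"
    by (simp add: supported_subspace_def W_def cdot_scale_right cdot_add_right) (simp add: cdot_def)
  have invW: "mvec D A w \<in> W" if A: "A \<in> F" and w: "w \<in> W" for A w
  proof -
    have "cdot D (v i) (mvec D A w) = 0" if "i < m" for i
    proof -
      obtain c where "mvec D A (v i) = (\<lambda>a. c * v i a)"
        using v A \<open>i < m\<close> unfolding orthonormal_in_def E_def by blast
      then show ?thesis
        using normal_eigenvector_adj[OF normal[OF A]] w \<open>i < m\<close> by (simp add: W_def)
    qed
    then show ?thesis using supp[OF A] by (simp add: W_def mvec_def)
  qed
  have W0: "w = (\<lambda>_. 0)" if "w \<in> W" for w
  proof (rule ccontr)
    assume "w \<noteq> (\<lambda>_. 0)"
    then obtain x where x: "x \<in> W" "x \<noteq> (\<lambda>_. 0)" "\<forall>A\<in>F. \<exists>c. mvec D A x = (\<lambda>a. c * x a)"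
      using common_eigenvector[OF subW \<open>w \<in> W\<close> _ invW comm] by blast
    have "\<exists>v'. orthonormal_in D E (Suc m) v'"
    proof (rule orthonormal_in_extend[OF v x(2)])
      fix c
      show "(\<lambda>a. c * x a) \<in> E"
        unfolding E_def
      proof (intro CollectI conjI ballI)
        fix A assume "A \<in> F"
        then obtain b where "mvec D A x = (\<lambda>a. b * x a)" using x by blast
        then show "\<exists>b. mvec D A (\<lambda>a. c * x a) = (\<lambda>a. b * (c * x a))"
          by (intro exI[of _ b]) (simp add: mvec_scale mult_ac)
      qed (use x in \<open>auto simp: W_def\<close>)
    qed (use x in \<open>auto simp: W_def\<close>)
    with m show False by blast
  qed
  show ?thesis
  proof (intro exI conjI allI impI)
    show "orthonormal_in D {v. \<forall>a\<ge>D. v a = 0} m v" using v by (auto simp: orthonormal_in_def E_def)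
    show "\<forall>A\<in>F. \<forall>i<m. \<exists>c. mvec D A (v i) = (\<lambda>a. c * v i a)"
      using v unfolding orthonormal_in_def E_def by blast
    fix x :: "nat \<Rightarrow> complex" assume x: "\<forall>a\<ge>D. x a = 0"
    have "(\<lambda>a. x a - (\<Sum>i<m. cdot D (v i) x * v i a)) \<in> W"
      unfolding W_def using orthonormal_in_remainder[OF v] x v
      by (auto simp: orthonormal_in_def E_def intro!: sum.neutral)
    from W0[OF this] show "x = (\<lambda>a. \<Sum>i<m. cdot D (v i) x * v i a)"
      by (auto simp: fun_eq_iff)
  qed
qed

section \<open>Multi-indices and partial traces in coordinates\<close>

lemma finite_multi_idx: "finite I \<Longrightarrow> finite (multi_idx d I)"
  unfolding multi_idx_def by (rule finite_PiE) auto

lemma upd_in_multi_idx_iff: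
  assumes "k \<in> I"
  shows "x(k := a) \<in> multi_idx d I \<longleftrightarrow> a < d k \<and> x(k := undefined) \<in> multi_idx d (I - {k})"
  using assms unfolding multi_idx_def PiE_iff extensional_def by (auto split: if_splits)

lemma in_multi_idx_iff:
  assumes "k \<in> I"
  shows "x \<in> multi_idx d I \<longleftrightarrow> x k < d k \<and> x(k := undefined) \<in> multi_idx d (I - {k})"
  using upd_in_multi_idx_iff[OF assms, of x "x k" d] by simp

lemma multi_idx_undefined: "x \<in> multi_idx d I \<Longrightarrow> k \<notin> I \<Longrightarrow> x k = undefined"
  unfolding multi_idx_def by (rule PiE_arb)

lemma multi_idx_upd_undefined: "x \<in> multi_idx d I \<Longrightarrow> k \<notin> I \<Longrightarrow> x(k := undefined) = x"
  by (metis fun_upd_triv multi_idx_undefined)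

lemma sum_multi_idx:
  assumes "k \<in> I"
  shows "(\<Sum>x\<in>multi_idx d I. F x) = (\<Sum>y\<in>multi_idx d (I - {k}). \<Sum>a<d k. F (y(k := a)))"
  unfolding sum.cartesian_product
proof (rule sum.reindex_bij_witness[of _ "\<lambda>(y, a). y(k := a)" "\<lambda>x. (x(k := undefined), x k)"])
  fix x assume "x \<in> multi_idx d I"
  then show "(x(k := undefined), x k) \<in> multi_idx d (I - {k}) \<times> {..<d k}"
    using in_multi_idx_iff[OF assms] by auto
next
  fix b assume b: "b \<in> multi_idx d (I - {k}) \<times> {..<d k}"
  then show "(case b of (y, a) \<Rightarrow> y(k := a)) \<in> multi_idx d I"
    by (auto simp: upd_in_multi_idx_iff[OF assms] multi_idx_upd_undefined)
  show "((case b of (y, a) \<Rightarrow> y(k := a))(k := undefined), (case b of (y, a) \<Rightarrow> y(k := a)) k) = b"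
    using b by (auto simp: multi_idx_upd_undefined)
qed auto

definition pt :: "nat \<Rightarrow> nat \<Rightarrow> nat \<Rightarrow> nat" where
  "pt k a = (\<lambda>_. undefined)(k := a)"

lemma pt_apply [simp]: "pt k a k = a"
  by (simp add: pt_def)

lemma multi_idx_empty [simp]: "multi_idx d {} = {\<lambda>_. undefined}"
  by (simp add: multi_idx_def)

lemma pt_in_multi_idx_iff [simp]: "pt k a \<in> multi_idx d {k} \<longleftrightarrow> a < d k"
  using upd_in_multi_idx_iff[of k "{k}" "\<lambda>_. undefined" a d] by (simp add: pt_def fun_upd_idem)

lemma in_multi_idx_single_iff: "x \<in> multi_idx d {k} \<longleftrightarrow> x = pt k (x k) \<and> x k < d k"
  using in_multi_idx_iff[of k "{k}" x d] by (auto simp: pt_def fun_eq_iff)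

lemma sum_multi_idx_single: "(\<Sum>x\<in>multi_idx d {k}. F x) = (\<Sum>a<d k. F (pt k a))"
  by (subst sum_multi_idx[of k]) (simp_all add: pt_def fun_upd_def)

lemma restrict_single: "restrict x {k} = pt k (x k)"
  by (auto simp: pt_def)

lemma hspace_zero: "u \<in> hspace d I \<Longrightarrow> x \<notin> multi_idx d I \<Longrightarrow> u x = 0"
  by (simp add: hspace_def)

lemma hspace_single_eqI:
  assumes "\<And>a. a < d k \<Longrightarrow> u (pt k a) = v (pt k a)" "u \<in> hspace d {k}" "v \<in> hspace d {k}"
  shows "u = v"
proof
  fix x
  show "u x = v x"
    using assms hspace_zero[of u d "{k}" x] hspace_zero[of v d "{k}" x]
    by (cases "x \<in> multi_idx d {k}") (metis in_multi_idx_single_iff, auto)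
qed

lemma hspace_undefined: "u \<in> hspace d I \<Longrightarrow> k \<notin> I \<Longrightarrow> x k \<noteq> undefined \<Longrightarrow> u x = 0"
  using multi_idx_undefined hspace_zero by metis

lemma braket_commute: "braket d I u v = cnj (braket d I v u)"
  by (simp add: braket_def mult.commute)

text \<open>The squared norm of \<open>u - v\<close> is 1 - 1 - 1 + 1 = 0. In this way a single
  overlap can identify a state.\<close>

lemma braket_eq_imp_eq:
  assumes "finite I" "u \<in> hspace d I" "v \<in> hspace d I"
    and "braket d I u u = 1" "braket d I v v = 1" "braket d I u v = 1"
  shows "u = v"
proof -
  have vu: "braket d I v u = 1" using braket_commute[of d I v u] assms by simp
  have "(\<Sum>x\<in>multi_idx d I. cnj (u x - v x) * (u x - v x))
      = braket d I u u - braket d I u v - braket d I v u + braket d I v v"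
    by (simp add: braket_def algebra_simps sum.distrib sum_subtractf)
  also have "\<dots> = 0" using assms vu by simp
  finally have "\<forall>x\<in>multi_idx d I. u x - v x = 0"
    by (subst (asm) sum_cnj_mult_eq_0_iff) (use finite_multi_idx assms in auto)
  then show ?thesis
    using assms(2,3) by (auto simp: hspace_def fun_eq_iff)
qed

text \<open>The entries of \<open>Tr\<^sub>j |u\<rangle>\<langle>v|\<close>: the indices \<open>x\<close> and \<open>y\<close> are full multi-indices whose
  \<open>j\<close>-th component is ignored.\<close>

definition marg :: "(nat \<Rightarrow> nat) \<Rightarrow> nat \<Rightarrow> qvec \<Rightarrow> qvec \<Rightarrow> (nat \<Rightarrow> nat) \<Rightarrow> (nat \<Rightarrow> nat) \<Rightarrow> complex" where
  "marg d j u v x y = (\<Sum>c<d j. u (x(j := c)) * cnj (v (y(j := c))))"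

text \<open>The entries of \<open>|u\<rangle>\<langle>v|\<close> traced over all parties but \<open>j\<close>.\<close>

definition gram :: "(nat \<Rightarrow> nat) \<Rightarrow> nat set \<Rightarrow> nat \<Rightarrow> qvec \<Rightarrow> qvec \<Rightarrow> nat \<Rightarrow> nat \<Rightarrow> complex" where
  "gram d I j u v a b = (\<Sum>y\<in>multi_idx d (I - {j}). u (y(j := a)) * cnj (v (y(j := b))))"

lemma marg_upd [simp]:
  "marg d j u v (x(j := a)) y = marg d j u v x y" "marg d j u v x (y(j := a)) = marg d j u v x y"
  by (simp_all add: marg_def)

lemma marg_eq_0:
  assumes "j \<in> I" "u \<in> hspace d I" "v \<in> hspace d I"
    and "x(j := undefined) \<notin> multi_idx d (I - {j}) \<or> y(j := undefined) \<notin> multi_idx d (I - {j})"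
  shows "marg d j u v x y = 0"
  unfolding marg_def
proof (rule sum.neutral, rule ballI)
  fix c
  have "x(j := c) \<notin> multi_idx d I \<or> y(j := c) \<notin> multi_idx d I"
    using assms upd_in_multi_idx_iff[OF assms(1)] by blast
  then show "u (x(j := c)) * cnj (v (y(j := c))) = 0"
    using assms hspace_zero by auto
qed

lemma merge_single:
  assumes "j \<in> I" "x \<in> multi_idx d (I - {j})"
  shows "merge (I - {j}) {j} (x, z) = x(j := z j)" "merge {j} (I - {j}) (z, x) = x(j := z j)"
  using assms by (auto simp: merge_def fun_eq_iff multi_idx_def PiE_iff extensional_def)

lemma partial_trace_single:
  assumes "j \<in> I" "x \<in> multi_idx d (I - {j})" "y \<in> multi_idx d (I - {j})"
  shows "partial_trace d I {j} (outer u v) x y = marg d j u v x y"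
  using assms
  by (simp add: partial_trace_def outer_def marg_def merge_single sum_multi_idx_single
      del: merge_singleton)

text \<open>Entries with an index out of range vanish on both sides, so the identity can be asserted
  for arbitrary functions \<open>x\<close> and \<open>y\<close>.\<close>

lemma partial_trace_eq_iff:
  assumes j: "j \<in> I" and u: "u \<in> hspace d I" and v: "v \<in> hspace d I"
  shows "partial_trace d I {j} (outer u u) = partial_trace d I {j} (outer v v)
    \<longleftrightarrow> (\<forall>x y. marg d j u u x y = marg d j v v x y)"
proof
  assume eq: "partial_trace d I {j} (outer u u) = partial_trace d I {j} (outer v v)"
  show "\<forall>x y. marg d j u u x y = marg d j v v x y"
  proof (intro allI)
    fix x y :: "nat \<Rightarrow> nat"
    let ?x = "x(j := undefined)" and ?y = "y(j := undefined)"
    show "marg d j u u x y = marg d j v v x y"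
    proof (cases "?x \<in> multi_idx d (I - {j}) \<and> ?y \<in> multi_idx d (I - {j})")
      case True
      then have "marg d j u u ?x ?y = marg d j v v ?x ?y"
        using partial_trace_single[OF j, of ?x d ?y] eq by metis
      then show ?thesis by simp
    next
      case False
      then show ?thesis using marg_eq_0[OF j u u] marg_eq_0[OF j v v] by auto
    qed
  qed
next
  assume "\<forall>x y. marg d j u u x y = marg d j v v x y"
  then show "partial_trace d I {j} (outer u u) = partial_trace d I {j} (outer v v)"
    using partial_trace_single[OF j]
    by (intro ext) (metis (no_types, lifting) partial_trace_def)
qed

section \<open>Kernels and supports of one-party reduced states\<close>

lemma reduced_state_pt:
  assumes "j \<in> I" "a < d j" "b < d j"
  shows "reduced_state d I j u (pt j a) (pt j b) = gram d I j u u a b"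
proof -
  have "I - (I - {j}) = {j}" using assms by auto
  then show ?thesis
    using assms
    by (simp add: reduced_state_def partial_trace_def outer_def gram_def merge_single)
qed

text \<open>The quadratic form of a reduced state is a sum of squared moduli, one for each slice of
  \<open>u\<close> along party \<open>j\<close>. This positivity lets the kernel be read off slice
  by slice.\<close>

lemma gram_sum_nonneg_form:
  "(\<Sum>a<d j. cnj (p a) * (\<Sum>b<d j. gram d I j u u a b * p b))
    = (\<Sum>y\<in>multi_idx d (I - {j}). cnj (\<Sum>b<d j. cnj (u (y(j := b))) * p b) * (\<Sum>b<d j. cnj (u (y(j := b))) * p b))"
proof -
  have "(\<Sum>a<d j. cnj (p a) * (\<Sum>b<d j. gram d I j u u a b * p b))
      = (\<Sum>a<d j. \<Sum>b<d j. \<Sum>y\<in>multi_idx d (I - {j}). cnj (p a) * u (y(j := a)) * (cnj (u (y(j := b))) * p b))"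
    by (simp add: gram_def sum_distrib_left sum_distrib_right mult_ac)
  also have "\<dots> = (\<Sum>a<d j. \<Sum>y\<in>multi_idx d (I - {j}). \<Sum>b<d j. cnj (p a) * u (y(j := a)) * (cnj (u (y(j := b))) * p b))"
    by (intro sum.cong refl sum.swap)
  also have "\<dots> = (\<Sum>y\<in>multi_idx d (I - {j}). \<Sum>a<d j. \<Sum>b<d j. cnj (p a) * u (y(j := a)) * (cnj (u (y(j := b))) * p b))"
    by (rule sum.swap)
  also have "\<dots> = (\<Sum>y\<in>multi_idx d (I - {j}). cnj (\<Sum>b<d j. cnj (u (y(j := b))) * p b) * (\<Sum>b<d j. cnj (u (y(j := b))) * p b))"
    by (simp add: sum_distrib_left sum_distrib_right mult_ac)
  finally show ?thesis .
qed

text \<open>On the kernel the quadratic form vanishes, hence so does the inner product with every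
  slice \<open>u (x(j := _))\<close>; conversely, each row of the reduced state is a combination of
  conjugated slices.\<close>

lemma op_apply_reduced_eq_0_iff:
  assumes I: "finite I" "j \<in> I" and u: "u \<in> hspace d I"
  shows "op_apply d {j} (reduced_state d I j u) p = (\<lambda>_. 0)
    \<longleftrightarrow> (\<forall>x. (\<Sum>b<d j. cnj (u (x(j := b))) * p (pt j b)) = 0)"
proof
  assume 0: "op_apply d {j} (reduced_state d I j u) p = (\<lambda>_. 0)"
  have *: "(\<Sum>b<d j. gram d I j u u a b * p (pt j b)) = 0" if "a < d j" for a
    using fun_cong[OF 0, of "pt j a"] that I
    by (simp add: op_apply_def sum_multi_idx_single reduced_state_pt)
  have "(\<Sum>y\<in>multi_idx d (I - {j}). cnj (\<Sum>b<d j. cnj (u (y(j := b))) * p (pt j b)) * (\<Sum>b<d j. cnj (u (y(j := b))) * p (pt j b))) = 0"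
    unfolding gram_sum_nonneg_form[symmetric, where p = "\<lambda>b. p (pt j b)"] using * by simp
  then have z: "(\<Sum>b<d j. cnj (u (y(j := b))) * p (pt j b)) = 0" if "y \<in> multi_idx d (I - {j})" for y
    by (subst (asm) sum_cnj_mult_eq_0_iff) (use finite_multi_idx I that in auto)
  show "\<forall>x. (\<Sum>b<d j. cnj (u (x(j := b))) * p (pt j b)) = 0"
  proof
    fix x
    show "(\<Sum>b<d j. cnj (u (x(j := b))) * p (pt j b)) = 0"
    proof (cases "x(j := undefined) \<in> multi_idx d (I - {j})")
      case True
      from z[OF this] show ?thesis by simp
    next
      case False
      then have "u (x(j := b)) = 0" for b
        using upd_in_multi_idx_iff[OF I(2)] hspace_zero[OF u] by blast
      then show ?thesis by simp
    qed
  qed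
next
  assume z: "\<forall>x. (\<Sum>b<d j. cnj (u (x(j := b))) * p (pt j b)) = 0"
  have *: "(\<Sum>b<d j. gram d I j u u a b * p (pt j b)) = 0" for a
  proof -
    have "(\<Sum>b<d j. gram d I j u u a b * p (pt j b))
       = (\<Sum>b<d j. \<Sum>y\<in>multi_idx d (I - {j}). u (y(j := a)) * (cnj (u (y(j := b))) * p (pt j b)))"
      by (simp add: gram_def sum_distrib_left sum_distrib_right mult_ac)
    also have "\<dots> = (\<Sum>y\<in>multi_idx d (I - {j}). \<Sum>b<d j. u (y(j := a)) * (cnj (u (y(j := b))) * p (pt j b)))"
      by (rule sum.swap)
    finally show ?thesis using z by (simp flip: sum_distrib_left)
  qed
  show "op_apply d {j} (reduced_state d I j u) p = (\<lambda>_. 0)"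
  proof (rule hspace_single_eqI[where d = d and k = j])
    fix a assume "a < d j"
    then show "op_apply d {j} (reduced_state d I j u) p (pt j a) = 0"
      using * I by (simp add: op_apply_def sum_multi_idx_single reduced_state_pt)
  qed (auto simp: hspace_def op_apply_def)
qed

text \<open>The slices of a vector along party \<open>j\<close> span the support of its reduced
  state, and \<open>marg d j u v\<close> lists the inner products between slices of \<open>u\<close>
  and slices of \<open>v\<close>. The proof avoids the span and works with the support as the
  orthogonal complement of the kernel.\<close>

lemma orthogonal_reduced_iff:
  assumes I: "finite I" "j \<in> I" and u: "u \<in> hspace d I" and v: "v \<in> hspace d I"
  shows "orthogonal_ops d {j} (reduced_state d I j u) (reduced_state d I j v)
    \<longleftrightarrow> (\<forall>x y. marg d j u v x y = 0)"
proof -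
  \<comment> \<open>The slice of \<open>w\<close> through \<open>x\<close> along party
    \<open>j\<close>, as a vector of the one-party space.\<close>
  define g where "g w x = (\<lambda>z. if z \<in> multi_idx d {j} then w (x(j := z j)) else 0)" for w :: qvec and x
  have gh: "g w x \<in> hspace d {j}" for w x by (simp add: g_def hspace_def)
  have gpt: "g w x (pt j a) = w (x(j := a))" if "a < d j" for w x a
    using that by (simp add: g_def)
  have br: "braket d {j} p q = (\<Sum>a<d j. cnj (p (pt j a)) * q (pt j a))" for p q
    by (simp add: braket_def sum_multi_idx_single)
  have ker: "op_apply d {j} (reduced_state d I j w) p = (\<lambda>_. 0)
      \<longleftrightarrow> (\<forall>x. braket d {j} (g w x) p = 0)" if "w \<in> hspace d I" for w p
    unfolding op_apply_reduced_eq_0_iff[OF I that] br by (simp add: gpt)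
  have gg: "braket d {j} (g v y) (g u x) = marg d j u v x y" for x y
    unfolding br marg_def by (simp add: gpt mult.commute)
  have gsupp: "g w x \<in> op_support d {j} (reduced_state d I j w)" if "w \<in> hspace d I" for w x
    unfolding op_support_def using gh ker[OF that] braket_commute[of d "{j}" _ "g w x"] by auto
  show ?thesis
  proof
    assume "orthogonal_ops d {j} (reduced_state d I j u) (reduced_state d I j v)"
    then have "braket d {j} (g u x) (g v y) = 0" for x y
      using gsupp[OF u] gsupp[OF v] by (simp add: orthogonal_ops_def)
    then show "\<forall>x y. marg d j u v x y = 0"
      using gg braket_commute by (metis complex_cnj_zero)
  next
    assume 0: "\<forall>x y. marg d j u v x y = 0"
    show "orthogonal_ops d {j} (reduced_state d I j u) (reduced_state d I j v)"
      unfolding orthogonal_ops_def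
    proof (intro ballI)
      fix p q
      assume p: "p \<in> op_support d {j} (reduced_state d I j u)"
        and q: "q \<in> op_support d {j} (reduced_state d I j v)"
      have "braket d {j} (g u x) (g v y) = 0" for x y
        using 0 gg braket_commute by (metis complex_cnj_zero)
      \<comment> \<open>Slices of \<open>v\<close> lie in the kernel for \<open>u\<close>, so they
        are orthogonal to \<open>p\<close>; hence \<open>p\<close> lies in the kernel for
        \<open>v\<close> and is orthogonal to \<open>q\<close>.\<close>
      then have "op_apply d {j} (reduced_state d I j u) (g v y) = (\<lambda>_. 0)" for y
        using ker[OF u] by simp
      then have "braket d {j} (g v y) p = 0" for y
        using p gh by (simp add: op_support_def)
      then have "op_apply d {j} (reduced_state d I j v) p = (\<lambda>_. 0)"
        using ker[OF v] by simp
      then show "braket d {j} p q = 0"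
        using q p by (simp add: op_support_def)
    qed
  qed
qed

lemma same_marginals_iff:
  assumes "psi \<in> hspace d {1..n}"
  shows "phi \<in> same_marginals d n psi \<longleftrightarrow>
    pure_state d {1..n} phi \<and> (\<forall>j\<in>{1..n}. \<forall>x y. marg d j psi psi x y = marg d j phi phi x y)"
  unfolding same_marginals_def pure_state_def
  using partial_trace_eq_iff[OF _ assms] by auto

lemma tensor_single:
  assumes k: "k \<in> I" and e: "e \<in> hspace d {k}" and f: "f \<in> hspace d (I - {k})"
  shows "tensor d {k} (I - {k}) e f = (\<lambda>x. e (pt k (x k)) * f (x(k := undefined)))"
proof
  fix x
  have I: "{k} \<union> (I - {k}) = I" using k by auto
  show "tensor d {k} (I - {k}) e f x = e (pt k (x k)) * f (x(k := undefined))"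
  proof (cases "x \<in> multi_idx d I")
    case True
    then have "restrict x (I - {k}) = x(k := undefined)"
      by (auto simp: multi_idx_def PiE_iff extensional_def)
    then show ?thesis using True unfolding tensor_def I restrict_single by simp
  next
    case False
    then have "e (pt k (x k)) = 0 \<or> f (x(k := undefined)) = 0"
      using in_multi_idx_iff[OF k] hspace_zero[OF e] hspace_zero[OF f] by auto
    then show ?thesis using False unfolding tensor_def I by auto
  qed
qed

section \<open>Changing the phases of Schmidt terms\<close>

declare One_nat_def [simp del]

lemma complete_partitionE:
  assumes "complete_partition X L S" "i \<in> X"
  obtains l where "l \<in> {1..L}" "i \<in> S l"
  using assms unfolding complete_partition_def by blast

lemma complete_partition_unique:
  assumes "complete_partition X L S" "l \<in> {1..L}" "i \<in> S l" "l' \<in> {1..L}" "i \<in> S l'"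
  shows "l' = l"
  using assms unfolding complete_partition_def disjoint_family_on_def by blast

lemma exp_2pi_of_unit:
  assumes "cmod z = 1"
  obtains t where "0 \<le> t" "t < 2 * pi" "exp (\<i> * complex_of_real t) = z"
proof (rule that[of "Arg2pi z"])
  show "0 \<le> Arg2pi z" by (rule Arg2pi_ge_0)
  show "Arg2pi z < 2 * pi" by (rule Arg2pi_lt_2pi)
  show "exp (\<i> * complex_of_real (Arg2pi z)) = z"
    using Arg2pi_eq[of z] assms by simp
qed

lemma unit_cnj: "cmod z = 1 \<Longrightarrow> cnj z * z = 1"
  using complex_norm_square[of z] by (simp add: mult.commute)

text \<open>Inner products of partial contractions with \<open>h\<close> depend only on the operator
  left after tracing out \<open>k\<close>. So states with equal marginals have contractions of equal
  norm.\<close>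

lemma sum_contract_product:
  "(\<Sum>a<d k. (\<Sum>y\<in>B. u (y(k := a)) * cnj (h y)) * cnj (\<Sum>y\<in>B. v (y(k := a)) * cnj (h y)))
    = (\<Sum>y\<in>B. \<Sum>z\<in>B. cnj (h y) * h z * marg d k u v y z)"
proof -
  have "(\<Sum>a<d k. (\<Sum>y\<in>B. u (y(k := a)) * cnj (h y)) * cnj (\<Sum>y\<in>B. v (y(k := a)) * cnj (h y)))
      = (\<Sum>a<d k. \<Sum>y\<in>B. \<Sum>z\<in>B. cnj (h y) * h z * (u (y(k := a)) * cnj (v (z(k := a)))))"
    unfolding cnj_sum sum_product by (intro sum.cong refl) (simp add: mult_ac)
  also have "\<dots> = (\<Sum>y\<in>B. \<Sum>a<d k. \<Sum>z\<in>B. cnj (h y) * h z * (u (y(k := a)) * cnj (v (z(k := a)))))"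
    by (rule sum.swap)
  also have "\<dots> = (\<Sum>y\<in>B. \<Sum>z\<in>B. \<Sum>a<d k. cnj (h y) * h z * (u (y(k := a)) * cnj (v (z(k := a)))))"
    by (intro sum.cong refl sum.swap)
  finally show ?thesis by (simp add: marg_def sum_distrib_left)
qed

locale schmidt =
  fixes d :: "nat \<Rightarrow> nat" and n k :: nat and psi :: qvec
    and M :: nat and lam :: "nat \<Rightarrow> real" and e f :: "nat \<Rightarrow> qvec"
  assumes k: "k \<in> {1..n}" and pure: "pure_state d {1..n} psi"
    and schmidt: "schmidt_decomposition d n k psi M lam e f"
begin

definition ev :: "nat \<Rightarrow> nat \<Rightarrow> complex" where
  "ev i a = e i (pt k a)"

text \<open>Weights of modulus 1 give the candidates for states with the marginals of
  \<open>psi\<close>.\<close>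

definition weighted :: "(nat \<Rightarrow> complex) \<Rightarrow> qvec" where
  "weighted w = (\<lambda>x. \<Sum>i=1..M. w i * schmidt_term d n k lam e f i x)"

definition sq :: "nat \<Rightarrow> complex" where
  "sq i = complex_of_real (sqrt (lam i))"

lemma lam_pos: "i \<in> {1..M} \<Longrightarrow> 0 < lam i"
  using schmidt by (simp add: schmidt_decomposition_def)

lemma sq_nz: "i \<in> {1..M} \<Longrightarrow> sq i \<noteq> 0"
  using lam_pos[of i] by (simp add: sq_def)

lemma sq_sq: "i \<in> {1..M} \<Longrightarrow> sq i * sq i = complex_of_real (lam i)"
  using lam_pos by (simp add: sq_def less_imp_le flip: of_real_mult)

lemma cnj_sq [simp]: "cnj (sq i) = sq i"
  by (simp add: sq_def)

lemma e_hspace: "i \<in> {1..M} \<Longrightarrow> e i \<in> hspace d {k}"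
  and f_hspace: "i \<in> {1..M} \<Longrightarrow> f i \<in> hspace d ({1..n} - {k})"
  using schmidt by (auto simp: schmidt_decomposition_def orthonormal_family_def)

lemma ev_orthonormal:
  assumes "i \<in> {1..M}" "j \<in> {1..M}"
  shows "(\<Sum>a<d k. cnj (ev i a) * ev j a) = (if i = j then 1 else 0)"
  using schmidt assms
  by (simp add: schmidt_decomposition_def orthonormal_family_def braket_def sum_multi_idx_single ev_def)

lemma f_orthonormal:
  assumes "i \<in> {1..M}" "j \<in> {1..M}"
  shows "(\<Sum>y\<in>multi_idx d ({1..n} - {k}). cnj (f i y) * f j y) = (if i = j then 1 else 0)"
  using schmidt assms
  by (simp add: schmidt_decomposition_def orthonormal_family_def braket_def)

lemma schmidt_term_eq:
  "i \<in> {1..M} \<Longrightarrow> schmidt_term d n k lam e f i x = sq i * (ev i (x k) * f i (x(k := undefined)))"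
  unfolding schmidt_term_def
  by (simp add: tensor_single[OF k e_hspace f_hspace] sq_def ev_def)

lemma weighted_eq:
  "weighted w x = (\<Sum>i=1..M. w i * sq i * ev i (x k) * f i (x(k := undefined)))"
  unfolding weighted_def by (intro sum.cong refl) (simp add: schmidt_term_eq mult.assoc)

lemma psi_weighted: "psi = weighted (\<lambda>_. 1)"
  using schmidt by (simp add: schmidt_decomposition_def weighted_def)

lemma weighted_hspace: "weighted w \<in> hspace d {1..n}"
  unfolding weighted_def schmidt_term_def hspace_def tensor_def
  using k by (auto intro!: sum.neutral simp: insert_absorb)

lemma weighted_upd:
  assumes "y \<in> multi_idx d ({1..n} - {k})"
  shows "weighted w (y(k := a)) = (\<Sum>i=1..M. w i * sq i * ev i a * f i y)"
  using multi_idx_upd_undefined[OF assms, of k] by (simp add: weighted_eq)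

lemma sum_f_weighted:
  assumes "i \<in> {1..M}"
  shows "(\<Sum>y\<in>multi_idx d ({1..n} - {k}). weighted w (y(k := a)) * cnj (f i y)) = w i * sq i * ev i a"
proof -
  have "(\<Sum>y\<in>multi_idx d ({1..n} - {k}). weighted w (y(k := a)) * cnj (f i y))
      = (\<Sum>y\<in>multi_idx d ({1..n} - {k}). \<Sum>j=1..M. w j * sq j * ev j a * (cnj (f i y) * f j y))"
    by (intro sum.cong refl) (simp add: weighted_upd sum_distrib_right sum_distrib_left mult_ac)
  also have "\<dots> = (\<Sum>j=1..M. \<Sum>y\<in>multi_idx d ({1..n} - {k}). w j * sq j * ev j a * (cnj (f i y) * f j y))"
    by (rule sum.swap)
  also have "\<dots> = (\<Sum>j=1..M. w j * sq j * ev j a * (if i = j then 1 else 0))"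
    by (intro sum.cong refl) (simp add: f_orthonormal[OF assms] flip: sum_distrib_left)
  also have "\<dots> = w i * sq i * ev i a" using assms by (simp add: sum.delta if_distrib cong: if_cong)
  finally show ?thesis .
qed

text \<open>Here \<open>phi\<close> is arbitrary: its overlap with a weighted state sees only its
  contractions with the vectors \<open>f i\<close>, which are exactly the data that
  \<open>eigen_imp_weighted\<close> is given.\<close>

lemma braket_weighted:
  "braket d {1..n} (weighted w) phi
    = (\<Sum>i=1..M. cnj (w i) * sq i *
        (\<Sum>a<d k. cnj (ev i a) * (\<Sum>y\<in>multi_idx d ({1..n} - {k}). phi (y(k := a)) * cnj (f i y))))"
proof -
  let ?B = "multi_idx d ({1..n} - {k})"
  have "braket d {1..n} (weighted w) phi = (\<Sum>y\<in>?B. \<Sum>a<d k. cnj (weighted w (y(k := a))) * phi (y(k := a)))"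
    unfolding braket_def by (rule sum_multi_idx[OF k])
  also have "\<dots> = (\<Sum>y\<in>?B. \<Sum>a<d k. \<Sum>i=1..M. cnj (w i) * sq i * (cnj (ev i a) * (phi (y(k := a)) * cnj (f i y))))"
    by (intro sum.cong refl) (simp add: weighted_upd sum_distrib_right sum_distrib_left mult_ac)
  also have "\<dots> = (\<Sum>y\<in>?B. \<Sum>i=1..M. \<Sum>a<d k. cnj (w i) * sq i * (cnj (ev i a) * (phi (y(k := a)) * cnj (f i y))))"
    by (intro sum.cong refl sum.swap)
  also have "\<dots> = (\<Sum>i=1..M. \<Sum>y\<in>?B. \<Sum>a<d k. cnj (w i) * sq i * (cnj (ev i a) * (phi (y(k := a)) * cnj (f i y))))"
    by (rule sum.swap)
  also have "\<dots> = (\<Sum>i=1..M. \<Sum>a<d k. \<Sum>y\<in>?B. cnj (w i) * sq i * (cnj (ev i a) * (phi (y(k := a)) * cnj (f i y))))"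
    by (intro sum.cong refl sum.swap)
  finally show ?thesis by (simp add: sum_distrib_left)
qed

lemma braket_weighted_weighted:
  "braket d {1..n} (weighted w) (weighted w') = (\<Sum>i=1..M. complex_of_real (lam i) * (cnj (w i) * w' i))"
  unfolding braket_weighted
proof (intro sum.cong refl)
  fix i assume i: "i \<in> {1..M}"
  have "(\<Sum>a<d k. cnj (ev i a) * (\<Sum>y\<in>multi_idx d ({1..n} - {k}). weighted w' (y(k := a)) * cnj (f i y)))
      = w' i * sq i * (\<Sum>a<d k. cnj (ev i a) * ev i a)"
    by (subst sum_f_weighted[OF i]) (simp add: sum_distrib_left mult_ac)
  also have "\<dots> = w' i * sq i"
    by (simp add: ev_orthonormal[OF i i])
  finally have eq: "(\<Sum>a<d k. cnj (ev i a) * (\<Sum>y\<in>multi_idx d ({1..n} - {k}). weighted w' (y(k := a)) * cnj (f i y)))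
      = w' i * sq i" .
  show "cnj (w i) * sq i * (\<Sum>a<d k. cnj (ev i a) * (\<Sum>y\<in>multi_idx d ({1..n} - {k}). weighted w' (y(k := a)) * cnj (f i y)))
      = complex_of_real (lam i) * (cnj (w i) * w' i)"
    unfolding eq sq_sq[OF i, symmetric] by (simp only: mult_ac)
qed

lemma sum_lam: "(\<Sum>i=1..M. lam i) = 1"
proof -
  have "complex_of_real (\<Sum>i=1..M. lam i) = 1"
    using pure braket_weighted_weighted[of "\<lambda>_. 1" "\<lambda>_. 1"]
    by (simp add: pure_state_def flip: psi_weighted)
  then show ?thesis by (simp only: of_real_eq_1_iff)
qed

lemma pure_weighted:
  assumes "\<forall>i\<in>{1..M}. cmod (w i) = 1"
  shows "pure_state d {1..n} (weighted w)"
proof -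
  have "(\<Sum>i=1..M. complex_of_real (lam i) * (cnj (w i) * w i)) = (\<Sum>i=1..M. complex_of_real (lam i))"
    using assms by (intro sum.cong refl) (simp add: unit_cnj)
  also have "\<dots> = 1" using sum_lam by (simp flip: of_real_sum)
  finally show ?thesis
    unfolding pure_state_def using weighted_hspace braket_weighted_weighted by simp
qed

text \<open>Party \<open>k\<close> is kept, so the cross terms between Schmidt indices
  \<open>r\<close> and \<open>t\<close> survive, each with the relative phase
  \<open>w r * cnj (w t)\<close>.\<close>

lemma marg_other_weighted:
  assumes "j \<noteq> k"
  shows "marg d j (weighted w) (weighted w) x y
    = (\<Sum>r=1..M. \<Sum>t=1..M. ev r (x k) * cnj (ev t (y k)) * (sq r * sq t * (w r * cnj (w t)) *
        marg d j (f r) (f t) (x(k := undefined)) (y(k := undefined))))"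
proof -
  have "marg d j (weighted w) (weighted w) x y
    = (\<Sum>c<d j. \<Sum>r=1..M. \<Sum>t=1..M. ev r (x k) * cnj (ev t (y k)) * (sq r * sq t * (w r * cnj (w t)) *
        (f r (x(k := undefined, j := c)) * cnj (f t (y(k := undefined, j := c))))))"
    unfolding marg_def weighted_eq cnj_sum sum_product
    using assms by (intro sum.cong refl) (simp add: fun_upd_twist[OF assms] mult_ac)
  also have "\<dots> = (\<Sum>r=1..M. \<Sum>c<d j. \<Sum>t=1..M. ev r (x k) * cnj (ev t (y k)) * (sq r * sq t * (w r * cnj (w t)) *
        (f r (x(k := undefined, j := c)) * cnj (f t (y(k := undefined, j := c))))))"
    by (rule sum.swap)
  also have "\<dots> = (\<Sum>r=1..M. \<Sum>t=1..M. \<Sum>c<d j. ev r (x k) * cnj (ev t (y k)) * (sq r * sq t * (w r * cnj (w t)) *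
        (f r (x(k := undefined, j := c)) * cnj (f t (y(k := undefined, j := c))))))"
    by (intro sum.cong refl sum.swap)
  finally show ?thesis by (simp add: marg_def sum_distrib_left)
qed

text \<open>Tracing out \<open>k\<close> kills the cross terms by orthonormality of the
  \<open>e i\<close>; only the moduli of the weights remain, so this marginal does not see
  phases.\<close>

lemma marg_k_weighted:
  "marg d k (weighted w) (weighted w) x y
    = (\<Sum>r=1..M. complex_of_real (lam r) * (cnj (w r) * w r) * (f r (x(k := undefined)) * cnj (f r (y(k := undefined)))))"
proof -
  let ?F = "\<lambda>r t. sq r * sq t * (w r * cnj (w t)) * (f r (x(k := undefined)) * cnj (f t (y(k := undefined))))"
  have "marg d k (weighted w) (weighted w) x y
    = (\<Sum>c<d k. \<Sum>r=1..M. \<Sum>t=1..M. ?F r t * (cnj (ev t c) * ev r c))"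
    unfolding marg_def weighted_eq cnj_sum sum_product
    by (intro sum.cong refl) (simp add: mult_ac)
  also have "\<dots> = (\<Sum>r=1..M. \<Sum>c<d k. \<Sum>t=1..M. ?F r t * (cnj (ev t c) * ev r c))"
    by (rule sum.swap)
  also have "\<dots> = (\<Sum>r=1..M. \<Sum>t=1..M. \<Sum>c<d k. ?F r t * (cnj (ev t c) * ev r c))"
    by (intro sum.cong refl sum.swap)
  also have "\<dots> = (\<Sum>r=1..M. \<Sum>t=1..M. ?F r t * (if t = r then 1 else 0))"
    by (intro sum.cong refl) (simp add: ev_orthonormal flip: sum_distrib_left)
  also have "\<dots> = (\<Sum>r=1..M. ?F r r)"
    by (intro sum.cong refl) (simp add: if_distrib cong: if_cong)
  also have "\<dots> = (\<Sum>r=1..M. complex_of_real (lam r) * (cnj (w r) * w r) * (f r (x(k := undefined)) * cnj (f r (y(k := undefined)))))"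
    by (intro sum.cong refl) (simp add: sq_sq[symmetric] mult_ac)
  finally show ?thesis .
qed

section \<open>Phase changes that preserve all marginals\<close>

lemma psi_hspace: "psi \<in> hspace d {1..n}"
  using pure by (simp add: pure_state_def)

lemma sum_ev_delta:
  assumes t: "t \<in> {1..M}"
  shows "(\<Sum>a<d k. cnj (ev t a) * (\<Sum>r=1..M. ev r a * X r)) = X t"
proof -
  have "(\<Sum>a<d k. cnj (ev t a) * (\<Sum>r=1..M. ev r a * X r)) = (\<Sum>a<d k. \<Sum>r=1..M. X r * (cnj (ev t a) * ev r a))"
    by (simp add: sum_distrib_left mult_ac)
  also have "\<dots> = (\<Sum>r=1..M. \<Sum>a<d k. X r * (cnj (ev t a) * ev r a))"
    by (rule sum.swap)
  also have "\<dots> = (\<Sum>r=1..M. X r * (if t = r then 1 else 0))"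
    by (intro sum.cong refl) (simp add: ev_orthonormal[OF t] flip: sum_distrib_left)
  also have "\<dots> = X t" using t by (simp add: if_distrib cong: if_cong)
  finally show ?thesis .
qed

lemma marg_f_eq_0_off:
  assumes "r \<in> {1..M}" "t \<in> {1..M}" "j \<noteq> k" "x k \<noteq> undefined \<or> y k \<noteq> undefined"
  shows "marg d j (f r) (f t) x y = 0"
  unfolding marg_def
proof (rule sum.neutral, rule ballI)
  fix c
  have "f r (x(j := c)) = 0 \<or> f t (y(j := c)) = 0"
    using assms hspace_undefined[OF f_hspace[OF assms(1)], of k "x(j := c)"]
      hspace_undefined[OF f_hspace[OF assms(2)], of k "y(j := c)"] by auto
  then show "f r (x(j := c)) * cnj (f t (y(j := c))) = 0" by auto
qed

text \<open>For a traced-out party \<open>j\<close> other than \<open>k\<close>, comparing the cross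
  terms at \<open>r\<close>, \<open>t\<close> shows that multiplication by
  \<open>w r * cnj (w t)\<close> must fix \<open>marg d j (f r) (f t)\<close>. For unit weights this
  factor is 1 exactly when the two phases agree, so the cross marginal has to vanish wherever they
  differ.\<close>

lemma weighted_same_marginals_iff:
  assumes w: "\<forall>i\<in>{1..M}. cmod (w i) = 1"
  shows "weighted w \<in> same_marginals d n psi \<longleftrightarrow>
    (\<forall>r\<in>{1..M}. \<forall>t\<in>{1..M}. w r \<noteq> w t \<longrightarrow>
       (\<forall>j\<in>{1..n} - {k}. \<forall>x y. marg d j (f r) (f t) x y = 0))"
    (is "?L \<longleftrightarrow> ?R")
proof
  assume ?R
  show ?L
    unfolding same_marginals_iff[OF psi_hspace]
  proof (intro conjI ballI allI)
    show "pure_state d {1..n} (weighted w)" by (rule pure_weighted[OF w])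
    fix j x y assume j: "j \<in> {1..n}"
    show "marg d j psi psi x y = marg d j (weighted w) (weighted w) x y"
    proof (cases "j = k")
      case True
      show ?thesis
        unfolding True psi_weighted marg_k_weighted
        using w by (intro sum.cong refl) (simp add: unit_cnj)
    next
      case False
      have *: "w r * cnj (w t) * marg d j (f r) (f t) x' y' = marg d j (f r) (f t) x' y'"
        if "r \<in> {1..M}" "t \<in> {1..M}" for r t x' y'
      proof (cases "w r = w t")
        case True
        then show ?thesis using w that unit_cnj[of "w t"] by (simp add: mult.commute)
      next
        case False
        with \<open>?R\<close> that j \<open>j \<noteq> k\<close> show ?thesis by simp
      qed
      show ?thesis
        unfolding psi_weighted marg_other_weighted[OF False]
      proof (intro sum.cong refl)
        fix r t assume "r \<in> {1..M}" "t \<in> {1..M}"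
        from *[OF this, of "x(k := undefined)" "y(k := undefined)"]
        show "ev r (x k) * cnj (ev t (y k)) * (sq r * sq t * (1 * cnj 1) * marg d j (f r) (f t) (x(k := undefined)) (y(k := undefined)))
          = ev r (x k) * cnj (ev t (y k)) * (sq r * sq t * (w r * cnj (w t)) * marg d j (f r) (f t) (x(k := undefined)) (y(k := undefined)))"
          by (simp only: mult.assoc complex_cnj_one mult_1)
      qed
    qed
  qed
next
  assume ?L
  show ?R
  proof (intro ballI impI allI)
    fix r t j x y
    assume r: "r \<in> {1..M}" and t: "t \<in> {1..M}" and ne: "w r \<noteq> w t" and j: "j \<in> {1..n} - {k}"
    show "marg d j (f r) (f t) x y = 0"
    \<comment> \<open>\<open>f r\<close> and \<open>f t\<close> live on the parties other than
      \<open>k\<close>, so the cross marginal vanishes as soon as an index has an entry at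
      \<open>k\<close> other than \<open>undefined\<close>.\<close>
    proof (cases "x k = undefined \<and> y k = undefined")
      case False
      then show ?thesis using marg_f_eq_0_off[OF r t] j by auto
    next
      case True
      then have xy: "x(k := undefined) = x" "y(k := undefined) = y" by (metis fun_upd_triv)+
      have jk: "j \<noteq> k" using j by simp
      \<comment> \<open>Contracting the two indices at \<open>k\<close> with \<open>e r\<close> and
        \<open>e t\<close> isolates a single cross term.\<close>
      have contract: "(\<Sum>b<d k. cnj (cnj (ev t b)) * (\<Sum>a<d k. cnj (ev r a) * marg d j (weighted v) (weighted v) (x(k := a)) (y(k := b))))
          = sq r * sq t * (v r * cnj (v t)) * marg d j (f r) (f t) x y" for v
      proof -
        define X where "X r t = sq r * sq t * (v r * cnj (v t)) * marg d j (f r) (f t) x y" for r t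
        have "marg d j (weighted v) (weighted v) (x(k := a)) (y(k := b))
            = (\<Sum>r=1..M. ev r a * (\<Sum>t=1..M. cnj (ev t b) * X r t))" for a b
          unfolding marg_other_weighted[OF jk] X_def
          by (simp add: xy sum_distrib_left mult.assoc)
        then have "(\<Sum>a<d k. cnj (ev r a) * marg d j (weighted v) (weighted v) (x(k := a)) (y(k := b)))
            = (\<Sum>t=1..M. cnj (ev t b) * X r t)" for b
          by (simp add: sum_ev_delta[OF r])
        moreover have "(\<Sum>b<d k. cnj (cnj (ev t b)) * (\<Sum>t=1..M. cnj (ev t b) * X r t))
            = cnj (\<Sum>b<d k. cnj (ev t b) * (\<Sum>t=1..M. ev t b * cnj (X r t)))"
          by simp
        ultimately show ?thesis by (simp add: sum_ev_delta[OF t] X_def)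
      qed
      have "marg d j (weighted w) (weighted w) x' y' = marg d j (weighted (\<lambda>_. 1)) (weighted (\<lambda>_. 1)) x' y'" for x' y'
        using \<open>?L\<close> j unfolding same_marginals_iff[OF psi_hspace] psi_weighted[symmetric] by simp
      then have "sq r * sq t * (w r * cnj (w t)) * marg d j (f r) (f t) x y = sq r * sq t * (1 * cnj 1) * marg d j (f r) (f t) x y"
        using contract[of w] contract[of "\<lambda>_. 1"] by simp
      then have "marg d j (f r) (f t) x y = 0 \<or> w r * cnj (w t) = 1"
        using sq_nz[OF r] sq_nz[OF t] by auto
      moreover have "w r * cnj (w t) \<noteq> 1"
      proof
        assume "w r * cnj (w t) = 1"
        then have "w r * (cnj (w t) * w t) = w t" by (metis mult.assoc mult_1)
        moreover have "cnj (w t) * w t = 1" using w t by (intro unit_cnj) blast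
        ultimately show False using ne by simp
      qed
      ultimately show ?thesis by blast
    qed
  qed
qed

section \<open>Locally orthogonal partitions and the states they generate\<close>

lemma orthogonal_iff:
  assumes "j \<in> {1..n} - {k}" "r \<in> {1..M}" "t \<in> {1..M}"
  shows "orthogonal_ops d {j} (reduced_state d ({1..n} - {k}) j (f r)) (reduced_state d ({1..n} - {k}) j (f t))
    \<longleftrightarrow> (\<forall>x y. marg d j (f r) (f t) x y = 0)"
  using assms by (intro orthogonal_reduced_iff f_hspace) auto

text \<open>Passes from one factor per block to one weight per Schmidt index; disjointness makes the
  block of an index unique.\<close>

lemma block_weight:
  assumes S: "complete_partition {1..M} L S"
  obtains w where "\<And>l i. l \<in> {1..L} \<Longrightarrow> i \<in> S l \<Longrightarrow> w i = g l"
    and "(\<lambda>x. \<Sum>l=1..L. g l * (\<Sum>i\<in>S l. schmidt_term d n k lam e f i x)) = weighted w"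
proof -
  define w where "w i = g (THE l. l \<in> {1..L} \<and> i \<in> S l)" for i
  have w: "w i = g l" if "l \<in> {1..L}" "i \<in> S l" for l i
  proof -
    have "(THE l. l \<in> {1..L} \<and> i \<in> S l) = l"
      by (rule the_equality) (use that complete_partition_unique[OF S that] in blast)+
    then show ?thesis by (simp add: w_def)
  qed
  have "(\<Sum>l=1..L. g l * (\<Sum>i\<in>S l. schmidt_term d n k lam e f i x)) = weighted w x" for x
  proof -
    have sub: "S l \<subseteq> {1..M}" if "l \<in> {1..L}" for l
      using S that by (auto simp: complete_partition_def)
    have "(\<Sum>l=1..L. g l * (\<Sum>i\<in>S l. schmidt_term d n k lam e f i x))
        = (\<Sum>l=1..L. \<Sum>i\<in>S l. w i * schmidt_term d n k lam e f i x)"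
      by (intro sum.cong refl) (simp add: sum_distrib_left w)
    also have "\<dots> = (\<Sum>i\<in>(\<Union>l\<in>{1..L}. S l). w i * schmidt_term d n k lam e f i x)"
    proof (rule sum.UNION_disjoint[symmetric])
      show "\<forall>l\<in>{1..L}. finite (S l)" using sub finite_subset by blast
      show "\<forall>l\<in>{1..L}. \<forall>l'\<in>{1..L}. l \<noteq> l' \<longrightarrow> S l \<inter> S l' = {}"
        using S unfolding complete_partition_def disjoint_family_on_def by blast
    qed simp
    also have "(\<Union>l\<in>{1..L}. S l) = {1..M}" using S by (simp add: complete_partition_def)
    finally show ?thesis by (simp add: weighted_def)
  qed
  with w show thesis by (intro that[of w]) auto
qed

text \<open>Equal factors on two blocks do no harm: only indices with different weights need
  orthogonality, and those lie in different blocks. The unit factors are general because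
  exponentials and signs are both used below.\<close>

lemma block_phase_statesD:
  assumes S: "locally_orthogonal_partition d n k M f L S"
    and g: "\<And>l. cmod (g l) = 1"
  shows "(\<lambda>x. \<Sum>l=1..L. g l * (\<Sum>i\<in>S l. schmidt_term d n k lam e f i x)) \<in> same_marginals d n psi"
proof -
  have part: "complete_partition {1..M} L S"
    using S by (simp add: locally_orthogonal_partition_def)
  obtain w where w: "\<And>l i. l \<in> {1..L} \<Longrightarrow> i \<in> S l \<Longrightarrow> w i = g l"
    and eq: "(\<lambda>x. \<Sum>l=1..L. g l * (\<Sum>i\<in>S l. schmidt_term d n k lam e f i x)) = weighted w"
    using block_weight[OF part, of g] by blast
  have ex: "\<exists>l\<in>{1..L}. i \<in> S l" if "i \<in> {1..M}" for i
    using complete_partitionE[OF part that] by blast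
  have unit: "\<forall>i\<in>{1..M}. cmod (w i) = 1"
  proof
    fix i assume "i \<in> {1..M}"
    then obtain l where "l \<in> {1..L}" "i \<in> S l" using ex by blast
    then show "cmod (w i) = 1" using w g by simp
  qed
  have "weighted w \<in> same_marginals d n psi"
    unfolding weighted_same_marginals_iff[OF unit]
  proof (intro ballI impI)
    fix r t j assume r: "r \<in> {1..M}" and t: "t \<in> {1..M}" and ne: "w r \<noteq> w t" and j: "j \<in> {1..n} - {k}"
    obtain l l' where l: "l \<in> {1..L}" "r \<in> S l" "l' \<in> {1..L}" "t \<in> S l'"
      using ex r t by blast
    then have "l \<noteq> l'" using ne w by auto
    then have "orthogonal_ops d {j} (reduced_state d ({1..n} - {k}) j (f r)) (reduced_state d ({1..n} - {k}) j (f t))"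
      using S l j unfolding locally_orthogonal_partition_def by blast
    then show "\<forall>x y. marg d j (f r) (f t) x y = 0"
      using orthogonal_iff[OF j r t] by blast
  qed
  with eq show ?thesis by simp
qed

lemma block_phase_states_subset: "block_phase_states d n k M lam e f \<subseteq> same_marginals d n psi"
proof
  fix phi assume "phi \<in> block_phase_states d n k M lam e f"
  then obtain L S theta where "locally_orthogonal_partition d n k M f L S"
    and "phi = (\<lambda>x. \<Sum>j=1..L. exp (\<i> * complex_of_real (theta j)) * (\<Sum>i\<in>S j. schmidt_term d n k lam e f i x))"
    unfolding block_phase_states_def by blast
  then show "phi \<in> same_marginals d n psi"
    using block_phase_statesD[of L S "\<lambda>j. exp (\<i> * complex_of_real (theta j))"] by simp
qed

text \<open>Flip the sign of one block. The overlap with \<open>psi\<close> becomes a signed sum of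
  the \<open>lam i\<close>; both signs occur and the \<open>lam i\<close> are positive with sum 1,
  so it lies strictly between -1 and 1.\<close>

lemma locally_undetermined_of_partition:
  assumes S: "locally_orthogonal_partition d n k M f L S"
  shows "locally_undetermined d n psi"
proof -
  define g where "g l = (if l = 1 then -1 else 1 :: complex)" for l :: nat
  define phi where "phi = (\<lambda>x. \<Sum>l=1..L. g l * (\<Sum>i\<in>S l. schmidt_term d n k lam e f i x))"
  have phi: "phi \<in> same_marginals d n psi"
    unfolding phi_def by (rule block_phase_statesD[OF S]) (simp add: g_def)
  have part: "complete_partition {1..M} L S" and L: "2 \<le> L"
    using S by (simp_all add: locally_orthogonal_partition_def)
  obtain w where w: "\<And>l i. l \<in> {1..L} \<Longrightarrow> i \<in> S l \<Longrightarrow> w i = g l" and eq: "phi = weighted w"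
    using block_weight[OF part, of g] unfolding phi_def by blast
  have nonempty: "S l \<noteq> {}" if "l \<in> {1..L}" for l
    using part that unfolding complete_partition_def by blast
  have sub: "S l \<subseteq> {1..M}" if "l \<in> {1..L}" for l
    using part that by (auto simp: complete_partition_def)
  obtain r where r: "r \<in> S 1" using nonempty[of 1] L by auto
  obtain t where t: "t \<in> S 2" using nonempty[of 2] L by auto
  have rt: "r \<in> {1..M}" "t \<in> {1..M}" "w r = -1" "w t = 1"
    using r t sub[of 1] sub[of 2] L w[of 1 r] w[of 2 t] by (auto simp: g_def)
  define s where "s i = (if w i = 1 then 1 else -1 :: real)" for i
  have w_pm: "w i = complex_of_real (s i)" if i: "i \<in> {1..M}" for i
  proof -
    obtain l where "l \<in> {1..L}" "i \<in> S l" by (rule complete_partitionE[OF part i])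
    then have "w i = g l" using w by blast
    then show ?thesis by (simp add: g_def s_def)
  qed
  have "braket d {1..n} phi psi = (\<Sum>i=1..M. complex_of_real (lam i) * (cnj (w i) * 1))"
    by (subst psi_weighted, unfold eq) (rule braket_weighted_weighted)
  also have "\<dots> = (\<Sum>i=1..M. complex_of_real (lam i * s i))"
  proof (intro sum.cong refl)
    fix i assume "i \<in> {1..M}"
    then show "complex_of_real (lam i) * (cnj (w i) * 1) = complex_of_real (lam i * s i)"
      by (subst w_pm) simp_all
  qed
  finally have br: "braket d {1..n} phi psi = complex_of_real (\<Sum>i=1..M. lam i * s i)"
    by simp
  \<comment> \<open>One index of each sign makes the bounds strict: \<open>r\<close> the upper one,
    \<open>t\<close> the lower one.\<close>
  have "(\<Sum>i=1..M. lam i * s i) < (\<Sum>i=1..M. lam i)"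
    using rt lam_pos less_imp_le[OF lam_pos] by (intro sum_strict_mono_ex1) (auto simp: s_def intro!: bexI[of _ r])
  moreover have "(\<Sum>i=1..M. - lam i) < (\<Sum>i=1..M. lam i * s i)"
    using rt lam_pos less_imp_le[OF lam_pos] by (intro sum_strict_mono_ex1) (auto simp: s_def intro!: bexI[of _ t])
  ultimately have "cmod (braket d {1..n} phi psi) \<noteq> 1"
    unfolding br norm_of_real using sum_lam by (simp add: sum_negf)
  with phi show ?thesis unfolding locally_undetermined_def by blast
qed

text \<open>The blocks are the level sets of \<open>w\<close>. A constant \<open>w\<close> has only
  one level set, short of the required two; it uses any available partition with the same phase on
  all blocks, whence the alternative in \<open>part\<close>.\<close>

lemma weighted_in_block_phase_states:
  assumes w: "\<forall>i\<in>{1..M}. cmod (w i) = 1" and same: "weighted w \<in> same_marginals d n psi"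
    and part: "(\<exists>L S. locally_orthogonal_partition d n k M f L S) \<or> (\<exists>r\<in>{1..M}. \<exists>t\<in>{1..M}. w r \<noteq> w t)"
  shows "weighted w \<in> block_phase_states d n k M lam e f"
proof -
  have "\<exists>L S g. locally_orthogonal_partition d n k M f L S \<and> (\<forall>l\<in>{1..L}. cmod (g l) = 1) \<and>
      (\<forall>l\<in>{1..L}. \<forall>i\<in>S l. w i = g l)"
  proof (cases "\<exists>r\<in>{1..M}. \<exists>t\<in>{1..M}. w r \<noteq> w t")
    case False
    then obtain L S where S: "locally_orthogonal_partition d n k M f L S" using part by blast
    then have sub: "S l \<subseteq> {1..M}" "S l \<noteq> {}" if "l \<in> {1..L}" for l
      using that unfolding locally_orthogonal_partition_def complete_partition_def by blast+
    have "1 \<in> {1..L}" using S by (auto simp: locally_orthogonal_partition_def)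
    then obtain r where r: "r \<in> {1..M}" using sub[of 1] by blast
    have "\<forall>l\<in>{1..L}. \<forall>i\<in>S l. w i = w r"
    proof (intro ballI)
      fix l i assume "l \<in> {1..L}" "i \<in> S l"
      then have "i \<in> {1..M}" using sub(1) by blast
      with False r show "w i = w r" by blast
    qed
    then show ?thesis using S w r
      by (intro exI[of _ L] exI[of _ S] exI[of _ "\<lambda>_. w r"]) auto
  next
    case True
    define V where "V = w ` {1..M}"
    have "finite V" by (simp add: V_def)
    then obtain g where g: "bij_betw g {1..card V} V"
      using ex_bij_betw_nat_finite_1 by blast
    define S where "S l = {i \<in> {1..M}. w i = g l}" for l
    have gV: "g l \<in> V" if "l \<in> {1..card V}" for l using g that by (auto simp: bij_betw_def)
    have inj: "g l = g l' \<longleftrightarrow> l = l'" if "l \<in> {1..card V}" "l' \<in> {1..card V}" for l l'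
      using bij_betw_imp_inj_on[OF g] that by (rule inj_on_eq_iff)
    have "2 \<le> card V"
    proof -
      obtain r t where "r \<in> {1..M}" "t \<in> {1..M}" "w r \<noteq> w t" using True by blast
      then have "card {w r, w t} \<le> card V" using \<open>finite V\<close> by (intro card_mono) (auto simp: V_def)
      with \<open>w r \<noteq> w t\<close> show ?thesis by simp
    qed
    moreover have "complete_partition {1..M} (card V) S"
      unfolding complete_partition_def
    proof (intro conjI ballI)
      fix l assume "l \<in> {1..card V}"
      then have "g l \<in> w ` {1..M}" using gV[of l] by (simp add: V_def)
      then obtain i where "i \<in> {1..M}" "g l = w i" by blast
      then have "i \<in> S l" by (simp add: S_def)
      then show "S l \<noteq> {}" by blast
    next
      show "disjoint_family_on S {1..card V}"
        unfolding disjoint_family_on_def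
      proof (intro ballI impI)
        fix l l' assume "l \<in> {1..card V}" "l' \<in> {1..card V}" "l \<noteq> l'"
        then have "g l \<noteq> g l'" using inj by blast
        then show "S l \<inter> S l' = {}" by (auto simp: S_def)
      qed
      have "\<exists>l\<in>{1..card V}. w i = g l" if "i \<in> {1..M}" for i
      proof -
        have "w i \<in> g ` {1..card V}" using g that by (auto simp: bij_betw_def V_def)
        then show ?thesis by auto
      qed
      then show "(\<Union>l\<in>{1..card V}. S l) = {1..M}" by (auto simp: S_def)
    qed
    moreover have "orthogonal_ops d {j} (reduced_state d ({1..n} - {k}) j (f r)) (reduced_state d ({1..n} - {k}) j (f t))"
      if "j \<in> {1..n} - {k}" "l \<in> {1..card V}" "l' \<in> {1..card V}" "l \<noteq> l'" "r \<in> S l" "t \<in> S l'" for j l l' r t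
    proof -
      have "r \<in> {1..M}" "t \<in> {1..M}" "w r \<noteq> w t"
        using that(5,6) inj[OF that(2,3)] that(4) by (simp_all add: S_def)
      then show ?thesis
        using same orthogonal_iff[OF that(1)] that(1) unfolding weighted_same_marginals_iff[OF w] by blast
    qed
    ultimately have "locally_orthogonal_partition d n k M f (card V) S"
      unfolding locally_orthogonal_partition_def by blast
    moreover have "cmod (g l) = 1" if "l \<in> {1..card V}" for l
      using gV[OF that] w by (auto simp: V_def)
    moreover have "\<forall>l\<in>{1..card V}. \<forall>i\<in>S l. w i = g l" by (simp add: S_def)
    ultimately show ?thesis by blast
  qed
  then obtain L S g where S: "locally_orthogonal_partition d n k M f L S"
    and g: "\<forall>l\<in>{1..L}. cmod (g l) = 1" and wg: "\<forall>l\<in>{1..L}. \<forall>i\<in>S l. w i = g l" by blast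
  have "\<forall>l\<in>{1..L}. \<exists>t. 0 \<le> t \<and> t < 2 * pi \<and> exp (\<i> * complex_of_real t) = g l"
    using g exp_2pi_of_unit by metis
  then obtain theta where theta: "\<forall>l\<in>{1..L}. 0 \<le> theta l \<and> theta l < 2 * pi \<and> exp (\<i> * complex_of_real (theta l)) = g l"
    by metis
  have part: "complete_partition {1..M} L S" using S by (simp add: locally_orthogonal_partition_def)
  obtain w' where w': "\<And>l i. l \<in> {1..L} \<Longrightarrow> i \<in> S l \<Longrightarrow> w' i = exp (\<i> * complex_of_real (theta l))"
    and eq: "(\<lambda>x. \<Sum>l=1..L. exp (\<i> * complex_of_real (theta l)) * (\<Sum>i\<in>S l. schmidt_term d n k lam e f i x)) = weighted w'"
    using block_weight[OF part, of "\<lambda>l. exp (\<i> * complex_of_real (theta l))"] by blast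
  have "w' i = w i" if "i \<in> {1..M}" for i
  proof -
    obtain l where "l \<in> {1..L}" "i \<in> S l"
      using complete_partitionE[OF part \<open>i \<in> {1..M}\<close>] by blast
    then show ?thesis using w' wg theta by simp
  qed
  then have "weighted w = weighted w'" by (simp add: weighted_def)
  then show ?thesis unfolding block_phase_states_def eq[symmetric] using S theta by blast
qed

text \<open>The contraction of \<open>phi\<close> with \<open>f i\<close> is known up to a factor,
  and the marginal with \<open>k\<close> traced out fixes the modulus of that factor. The overlap of
  \<open>phi\<close> with the resulting weighted state is then the sum of the \<open>lam i\<close>,
  which is 1; so the two coincide, and \<open>phi\<close> has no component beyond the Schmidt
  terms.\<close>

lemma eigen_imp_weighted:
  assumes phi: "phi \<in> same_marginals d n psi"
    and eig: "\<forall>i\<in>{1..M}. \<exists>c. \<forall>a<d k. (\<Sum>y\<in>multi_idx d ({1..n} - {k}). phi (y(k := a)) * cnj (f i y)) = c * ev i a"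
  shows "\<exists>w. (\<forall>i\<in>{1..M}. cmod (w i) = 1) \<and> phi = weighted w"
proof -
  let ?B = "multi_idx d ({1..n} - {k})"
  obtain c where c: "\<And>i a. i \<in> {1..M} \<Longrightarrow> a < d k \<Longrightarrow> (\<Sum>y\<in>?B. phi (y(k := a)) * cnj (f i y)) = c i * ev i a"
    using bchoice[OF eig] by blast
  have pphi: "pure_state d {1..n} phi" and mk: "\<And>x y. marg d k phi phi x y = marg d k psi psi x y"
    using phi k unfolding same_marginals_iff[OF psi_hspace] by (blast, metis)
  have cc: "c i * cnj (c i) = sq i * sq i" if i: "i \<in> {1..M}" for i
  proof -
    have 1: "(\<Sum>a<d k. b * ev i a * cnj (b * ev i a)) = b * cnj b" for b
    proof -
      have "(\<Sum>a<d k. b * ev i a * cnj (b * ev i a)) = b * cnj b * (\<Sum>a<d k. cnj (ev i a) * ev i a)"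
        unfolding sum_distrib_left by (intro sum.cong refl) simp
      then show ?thesis unfolding ev_orthonormal[OF i i] by simp
    qed
    have "c i * cnj (c i) = (\<Sum>a<d k. (\<Sum>y\<in>?B. phi (y(k := a)) * cnj (f i y)) * cnj (\<Sum>y\<in>?B. phi (y(k := a)) * cnj (f i y)))"
      unfolding 1[of "c i", symmetric] using c[OF i] by (intro sum.cong refl) simp
    also have "\<dots> = (\<Sum>a<d k. (\<Sum>y\<in>?B. psi (y(k := a)) * cnj (f i y)) * cnj (\<Sum>y\<in>?B. psi (y(k := a)) * cnj (f i y)))"
      unfolding sum_contract_product mk ..
    also have "\<dots> = (\<Sum>a<d k. sq i * ev i a * cnj (sq i * ev i a))"
      using sum_f_weighted[OF i, of "\<lambda>_. 1"] by (simp add: psi_weighted[symmetric])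
    also have "\<dots> = sq i * sq i" using 1[of "sq i"] by simp
    finally show ?thesis .
  qed
  \<comment> \<open>By \<open>cc\<close> the squared modulus of \<open>c i\<close> is
    \<open>lam i\<close>, so the quotient is a phase.\<close>
  define w where "w i = c i / sq i" for i
  have w1: "cnj (w i) * w i = 1" if "i \<in> {1..M}" for i
    using cc[OF that] sq_nz[OF that] by (simp add: w_def mult.commute)
  have unit: "\<forall>i\<in>{1..M}. cmod (w i) = 1"
  proof
    fix i assume "i \<in> {1..M}"
    then have "complex_of_real ((cmod (w i))\<^sup>2) = 1"
      using w1[of i] unfolding complex_norm_square by (simp add: mult.commute)
    then have "(cmod (w i))\<^sup>2 = 1" by (simp only: of_real_eq_1_iff)
    then show "cmod (w i) = 1" by (simp add: power2_eq_1_iff) (smt (verit) norm_ge_zero)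
  qed
  have "braket d {1..n} (weighted w) phi = (\<Sum>i=1..M. complex_of_real (lam i))"
    unfolding braket_weighted
  proof (intro sum.cong refl)
    fix i assume i: "i \<in> {1..M}"
    have "(\<Sum>a<d k. cnj (ev i a) * (\<Sum>y\<in>?B. phi (y(k := a)) * cnj (f i y))) = c i * (\<Sum>a<d k. cnj (ev i a) * ev i a)"
      using c[OF i] by (simp add: sum_distrib_left mult_ac)
    then have "cnj (w i) * sq i * (\<Sum>a<d k. cnj (ev i a) * (\<Sum>y\<in>?B. phi (y(k := a)) * cnj (f i y)))
        = cnj (w i) * w i * (sq i * sq i)"
      using sq_nz[OF i] by (simp add: ev_orthonormal[OF i i] w_def)
    then show "cnj (w i) * sq i * (\<Sum>a<d k. cnj (ev i a) * (\<Sum>y\<in>?B. phi (y(k := a)) * cnj (f i y))) = complex_of_real (lam i)"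
      using w1[OF i] sq_sq[OF i] by simp
  qed
  also have "\<dots> = 1" using sum_lam by (simp flip: of_real_sum)
  finally have "weighted w = phi"
    using pure_weighted[OF unit] pphi by (intro braket_eq_imp_eq) (auto simp: pure_state_def)
  with unit show ?thesis by blast
qed

end

section \<open>Local operators relating states with equal marginals\<close>

lemma gram_eq_0:
  assumes "k \<in> I" "u \<in> hspace d I" "d k \<le> a"
  shows "gram d I k u v a b = 0"
  unfolding gram_def
  using assms upd_in_multi_idx_iff[OF assms(1)] hspace_zero[OF assms(2)]
  by (intro sum.neutral) (metis mult_zero_left not_less)

lemma adj_gram: "adj (gram d I k u v) = gram d I k v u"
  by (intro ext) (simp add: adj_def gram_def mult.commute)

lemma mmult_gram:
  "mmult (d k) (gram d I k u v) (gram d I k v' w) a b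
    = (\<Sum>y\<in>multi_idx d (I - {k}). \<Sum>z\<in>multi_idx d (I - {k}). u (y(k := a)) * cnj (w (z(k := b))) * marg d k v' v z y)"
proof -
  let ?B = "multi_idx d (I - {k})"
  have "mmult (d k) (gram d I k u v) (gram d I k v' w) a b
    = (\<Sum>c<d k. \<Sum>y\<in>?B. \<Sum>z\<in>?B. u (y(k := a)) * cnj (w (z(k := b))) * (v' (z(k := c)) * cnj (v (y(k := c)))))"
    unfolding mmult_def gram_def sum_product by (intro sum.cong refl) (simp add: mult_ac)
  also have "\<dots> = (\<Sum>y\<in>?B. \<Sum>c<d k. \<Sum>z\<in>?B. u (y(k := a)) * cnj (w (z(k := b))) * (v' (z(k := c)) * cnj (v (y(k := c)))))"
    by (rule sum.swap)
  also have "\<dots> = (\<Sum>y\<in>?B. \<Sum>z\<in>?B. \<Sum>c<d k. u (y(k := a)) * cnj (w (z(k := b))) * (v' (z(k := c)) * cnj (v (y(k := c)))))"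
    by (intro sum.cong refl sum.swap)
  finally show ?thesis by (simp add: marg_def sum_distrib_left)
qed

text \<open>In matrix terms \<open>gram u v\<close> is \<open>U V^*\<close>, and the middle factor
  \<open>V^* V'\<close> of a product is, up to transposition, \<open>marg d k v' v\<close>. The
  inner pair can therefore be exchanged for any pair with the same partial trace.\<close>

lemma mmult_gram_cong:
  assumes "\<And>x y. marg d k v' v x y = marg d k s' s x y"
  shows "mmult (d k) (gram d I k u v) (gram d I k v' w) = mmult (d k) (gram d I k u s) (gram d I k s' w)"
  by (intro ext) (simp add: mmult_gram assms)

text \<open>Tracing out all parties but \<open>k\<close> can begin with \<open>j\<close>, so one
  equal marginal already fixes the reduced state on \<open>k\<close>.\<close>

lemma gram_cong:
  assumes "j \<in> I" "j \<noteq> k" and eq: "\<And>x y. marg d j u u x y = marg d j v v x y"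
  shows "gram d I k u u = gram d I k v v"
proof (intro ext)
  fix a b
  have j: "j \<in> I - {k}" using assms by simp
  have "gram d I k w w a b = (\<Sum>y\<in>multi_idx d (I - {k} - {j}). marg d j w w (y(k := a)) (y(k := b)))" for w
    unfolding gram_def sum_multi_idx[OF j] marg_def fun_upd_twist[OF assms(2)] ..
  then show "gram d I k u u a b = gram d I k v v a b" by (simp add: eq)
qed

definition act :: "(nat \<Rightarrow> nat) \<Rightarrow> nat \<Rightarrow> (nat \<Rightarrow> nat \<Rightarrow> complex) \<Rightarrow> qvec \<Rightarrow> qvec" where
  "act d k U u = (\<lambda>x. \<Sum>a<d k. U (x k) a * u (x(k := a)))"

lemma act_commute:
  assumes "j \<noteq> k"
  shows "act d k U (act d j V u) = act d j V (act d k U u)"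
proof
  fix x
  have "act d k U (act d j V u) x = (\<Sum>a<d k. \<Sum>b<d j. U (x k) a * (V (x j) b * u (x(k := a, j := b))))"
    using assms by (simp add: act_def sum_distrib_left)
  also have "\<dots> = (\<Sum>b<d j. \<Sum>a<d k. U (x k) a * (V (x j) b * u (x(k := a, j := b))))"
    by (rule sum.swap)
  also have "\<dots> = act d j V (act d k U u) x"
    using assms by (simp add: act_def sum_distrib_left mult_ac fun_upd_twist[OF assms])
  finally show "act d k U (act d j V u) x = act d j V (act d k U u) x" .
qed

lemma gram_act: "gram d I k (act d k U u) v = mmult (d k) U (gram d I k u v)"
proof (intro ext)
  fix a b
  have "gram d I k (act d k U u) v a b = (\<Sum>y\<in>multi_idx d (I - {k}). \<Sum>c<d k. U a c * (u (y(k := c)) * cnj (v (y(k := b)))))"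
    by (simp add: gram_def act_def sum_distrib_right mult.assoc)
  also have "\<dots> = (\<Sum>c<d k. \<Sum>y\<in>multi_idx d (I - {k}). U a c * (u (y(k := c)) * cnj (v (y(k := b)))))"
    by (rule sum.swap)
  finally show "gram d I k (act d k U u) v a b = mmult (d k) U (gram d I k u v) a b"
    by (simp add: mmult_def gram_def sum_distrib_left)
qed

lemma mvec_gram:
  "mvec (d k) (gram d I k u v) h a
    = (\<Sum>y\<in>multi_idx d (I - {k}). u (y(k := a)) * cnj (\<Sum>b<d k. cnj (h b) * v (y(k := b))))"
proof -
  have "mvec (d k) (gram d I k u v) h a
      = (\<Sum>b<d k. \<Sum>y\<in>multi_idx d (I - {k}). u (y(k := a)) * (h b * cnj (v (y(k := b)))))"
    by (simp add: mvec_def gram_def sum_distrib_left mult_ac)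
  also have "\<dots> = (\<Sum>y\<in>multi_idx d (I - {k}). \<Sum>b<d k. u (y(k := a)) * (h b * cnj (v (y(k := b)))))"
    by (rule sum.swap)
  finally show ?thesis by (simp add: sum_distrib_left)
qed

lemma cdot_mvec_gram:
  "cdot (d k) g (mvec (d k) (gram d I k u v) h)
    = (\<Sum>y\<in>multi_idx d (I - {k}). cnj (\<Sum>b<d k. cnj (h b) * v (y(k := b))) * (\<Sum>a<d k. cnj (g a) * u (y(k := a))))"
proof -
  let ?C = "\<lambda>y. cnj (\<Sum>b<d k. cnj (h b) * v (y(k := b)))"
  have "cdot (d k) g (mvec (d k) (gram d I k u v) h)
      = (\<Sum>a<d k. \<Sum>y\<in>multi_idx d (I - {k}). ?C y * (cnj (g a) * u (y(k := a))))"
    unfolding cdot_def mvec_gram sum_distrib_left by (intro sum.cong refl) (simp only: mult_ac)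
  also have "\<dots> = (\<Sum>y\<in>multi_idx d (I - {k}). \<Sum>a<d k. ?C y * (cnj (g a) * u (y(k := a))))"
    by (rule sum.swap)
  finally show ?thesis by (simp only: sum_distrib_left)
qed

text \<open>For \<open>phi\<close> with the marginals of \<open>psi\<close>, cycling the equal marginals through products of the
  operators \<open>gram\<close> shows that \<open>gram phi psi\<close> is normal and commutes with the reduced state of
  \<open>psi\<close> on party \<open>k\<close>.\<close>

lemma
  assumes n: "2 \<le> n" and psi: "psi \<in> hspace d {1..n}" and k: "k \<in> {1..n}"
    and phi: "phi \<in> same_marginals d n psi"
  shows gram_commute_rho: "mmult (d k) (gram d {1..n} k phi psi) (gram d {1..n} k psi psi)
      = mmult (d k) (gram d {1..n} k psi psi) (gram d {1..n} k phi psi)"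
    and gram_normal: "mmult (d k) (gram d {1..n} k phi psi) (adj (gram d {1..n} k phi psi))
      = mmult (d k) (adj (gram d {1..n} k phi psi)) (gram d {1..n} k phi psi)"
proof -
  obtain j where j: "j \<in> {1..n}" "j \<noteq> k"
    using n by (cases "k = 1") (auto intro: that[of 2] that[of 1])
  have eq: "marg d i psi psi x y = marg d i phi phi x y" if "i \<in> {1..n}" for i x y
    using phi that unfolding same_marginals_iff[OF psi] by blast
  have 1: "gram d {1..n} k phi phi = gram d {1..n} k psi psi"
    by (rule gram_cong[OF j]) (simp add: eq[OF j(1)])
  show "mmult (d k) (gram d {1..n} k phi psi) (gram d {1..n} k psi psi)
      = mmult (d k) (gram d {1..n} k psi psi) (gram d {1..n} k phi psi)"
    \<comment> \<open>The inner pair \<open>psi\<close>, \<open>psi\<close> becomes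
      \<open>phi\<close>, \<open>phi\<close>; the first factor is then \<open>gram phi phi\<close>,
      which equals the reduced state of \<open>psi\<close>.\<close>
    unfolding mmult_gram_cong[of d k psi psi phi phi "{1..n}" phi psi, OF eq[OF k]] 1 ..
  show "mmult (d k) (gram d {1..n} k phi psi) (adj (gram d {1..n} k phi psi))
      = mmult (d k) (adj (gram d {1..n} k phi psi)) (gram d {1..n} k phi psi)"
    unfolding adj_gram
    unfolding mmult_gram_cong[of d k psi psi phi phi "{1..n}" phi phi, OF eq[OF k]]
      mmult_gram_cong[of d k phi phi psi psi "{1..n}" psi psi, OF eq[OF k, symmetric]] 1 ..
qed

text \<open>Expand \<open>psi\<close> along a common orthonormal eigenbasis on party
  \<open>k\<close>. The reduced state of \<open>psi\<close> is diagonal there, so the coefficient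
  vectors on the other parties are orthogonal and normalising them gives a Schmidt decomposition.
  The other diagonalised operators give the conclusion about \<open>R\<close>.\<close>

lemma schmidt_decomposition_exists:
  assumes n: "2 \<le> n" and pure: "pure_state d {1..n} psi" and k: "k \<in> {1..n}"
    and R: "R \<subseteq> same_marginals d n psi"
    and comm: "\<And>phi phi'. phi \<in> R \<Longrightarrow> phi' \<in> R \<Longrightarrow>
      mmult (d k) (gram d {1..n} k phi psi) (gram d {1..n} k phi' psi)
      = mmult (d k) (gram d {1..n} k phi' psi) (gram d {1..n} k phi psi)"
  obtains M lam e f where "schmidt_decomposition d n k psi M lam e f"
    and "\<And>phi. phi \<in> R \<Longrightarrow> \<forall>i\<in>{1..M}. \<exists>c. \<forall>a<d k.
      (\<Sum>y\<in>multi_idx d ({1..n} - {k}). phi (y(k := a)) * cnj (f i y)) = c * e i (pt k a)"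
proof -
  let ?I = "{1..n}"
  let ?B = "multi_idx d (?I - {k})"
  have psi: "psi \<in> hspace d ?I" using pure by (simp add: pure_state_def)
  have psi_same: "psi \<in> same_marginals d n psi" using pure by (simp add: same_marginals_def)
  \<comment> \<open>Inserting \<open>psi\<close> puts its reduced state \<open>gram psi psi\<close>
    among the operators to be diagonalised.\<close>
  define F where "F = (\<lambda>phi. gram d ?I k phi psi) ` insert psi R"
  have R': "insert psi R \<subseteq> same_marginals d n psi" using R psi_same by simp
  have F_supp: "A a b = 0" if "A \<in> F" "d k \<le> a" for A a b
  proof -
    from that obtain phi where "phi \<in> same_marginals d n psi" "A = gram d ?I k phi psi"
      using R' by (auto simp: F_def)
    moreover from this have "phi \<in> hspace d ?I"
      by (simp add: same_marginals_def pure_state_def)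
    ultimately show "A a b = 0" using gram_eq_0[OF k] \<open>d k \<le> a\<close> by simp
  qed
  have F_comm: "mmult (d k) A B = mmult (d k) B A" if "A \<in> F" "B \<in> F" for A B
  proof -
    from that obtain p q where p: "p \<in> insert psi R" "A = gram d ?I k p psi"
      and q: "q \<in> insert psi R" "B = gram d ?I k q psi"
      unfolding F_def by blast
    have "p \<in> same_marginals d n psi" "q \<in> same_marginals d n psi" using p q R' by blast+
    then show ?thesis
      using p q comm gram_commute_rho[OF n psi k] by (metis insertE)
  qed
  have F_normal: "mmult (d k) A (adj A) = mmult (d k) (adj A) A" if "A \<in> F" for A
    using that R' gram_normal[OF n psi k] by (auto simp: F_def)
  have "\<exists>m v. orthonormal_in (d k) {v. \<forall>a\<ge>d k. v a = 0} m v \<and>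
      (\<forall>A\<in>F. \<forall>i<m. \<exists>c. mvec (d k) A (v i) = (\<lambda>a. c * v i a)) \<and>
      (\<forall>x. (\<forall>a\<ge>d k. x a = 0) \<longrightarrow> x = (\<lambda>a. \<Sum>i<m. cdot (d k) (v i) x * v i a))"
    by (rule simultaneous_diagonalization) (rule F_supp F_comm F_normal; assumption)+
  then obtain m v where v: "orthonormal_in (d k) {v. \<forall>a\<ge>d k. v a = 0} m v"
    and eig: "\<forall>A\<in>F. \<forall>i<m. \<exists>c. mvec (d k) A (v i) = (\<lambda>a. c * v i a)"
    and complete: "\<forall>x. (\<forall>a\<ge>d k. x a = 0) \<longrightarrow> x = (\<lambda>a. \<Sum>i<m. cdot (d k) (v i) x * v i a)"
    by blast
  have v_supp: "v i a = 0" if "i < m" "d k \<le> a" for i a using v that by (simp add: orthonormal_in_def)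
  have v_orth: "cdot (d k) (v i) (v j) = (if i = j then 1 else 0)" if "i < m" "j < m" for i j
    using v that by (simp add: orthonormal_in_def)
  define c where "c i y = (if y \<in> ?B then \<Sum>a<d k. cnj (v i a) * psi (y(k := a)) else 0)" for i y
  have psi_c: "psi (y(k := a)) = (\<Sum>i<m. v i a * c i y)" if "y \<in> ?B" for y a
  proof -
    have "\<forall>a\<ge>d k. psi (y(k := a)) = 0"
      using hspace_zero[OF psi] upd_in_multi_idx_iff[OF k] by (metis not_less)
    from fun_cong[OF complete[THEN spec, THEN mp, OF this], of a] show ?thesis
      using that by (simp add: c_def cdot_def mult.commute)
  qed
  define r where "r i = (\<Sum>y\<in>?B. (cmod (c i y))\<^sup>2)" for i
  have c_orth: "(\<Sum>y\<in>?B. cnj (c j y) * c i y) = (if i = j then of_real (r j) else 0)"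
    if "i < m" "j < m" for i j
  proof -
    have "gram d ?I k psi psi \<in> F" by (simp add: F_def)
    then obtain mu where mu: "mvec (d k) (gram d ?I k psi psi) (v j) = (\<lambda>a. mu * v j a)"
      using eig \<open>j < m\<close> by blast
    have *: "(\<Sum>y\<in>?B. cnj (c j y) * c i y) = mu * (if i = j then 1 else 0)" if "i < m" for i
    proof -
      have "(\<Sum>y\<in>?B. cnj (c j y) * c i y) = cdot (d k) (v i) (mvec (d k) (gram d ?I k psi psi) (v j))"
        unfolding cdot_mvec_gram by (intro sum.cong refl) (simp add: c_def)
      then show ?thesis unfolding mu cdot_scale_right using v_orth that \<open>j < m\<close> by simp
    qed
    have "(\<Sum>y\<in>?B. cnj (c j y) * c j y) = of_real (r j)"
      unfolding r_def by (rule sum_cnj_mult)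
    \<comment> \<open>The diagonal case identifies the eigenvalue with the squared norm of the
      coefficient vector.\<close>
    then have "mu = of_real (r j)" using *[OF that(2)] by simp
    then show ?thesis using *[OF that(1)] by simp
  qed
  have r_nonneg: "0 \<le> r i" for i unfolding r_def by (intro sum_nonneg) simp
  have r_0: "c i y = 0" if "r i = 0" for i y
  proof (cases "y \<in> ?B")
    case True
    then show ?thesis
      using that finite_multi_idx[of "?I - {k}" d] by (simp add: r_def sum_nonneg_eq_0_iff)
  qed (simp add: c_def)
  \<comment> \<open>Directions with \<open>r i = 0\<close> have zero coefficient vectors and are
    dropped, since Schmidt coefficients must be positive; \<open>h\<close> renumbers the rest from
    1.\<close>
  define N where "N = {i. i < m \<and> r i \<noteq> 0}"
  define M where "M = card N"
  have finN: "finite N" by (simp add: N_def)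
  then obtain h where h: "bij_betw h {1..M} N"
    unfolding M_def using ex_bij_betw_nat_finite_1 by blast
  have hN: "h s < m" "0 < r (h s)" if "s \<in> {1..M}" for s
  proof -
    have "h s \<in> N" using h that by (auto simp: bij_betw_def)
    then show "h s < m" "0 < r (h s)" using r_nonneg[of "h s"] by (auto simp: N_def less_le)
  qed
  have h_inj: "h s = h t \<longleftrightarrow> s = t" if "s \<in> {1..M}" "t \<in> {1..M}" for s t
    using bij_betw_imp_inj_on[OF h] that by (rule inj_on_eq_iff)
  define lam where "lam s = r (h s)" for s
  define e where "e s x = (if x \<in> multi_idx d {k} then v (h s) (x k) else 0)" for s x
  define f where "f s y = c (h s) y / of_real (sqrt (lam s))" for s y
  have e_pt: "e s (pt k a) = v (h s) a" if "s \<in> {1..M}" for s a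
    using v_supp[OF hN(1)[OF that], of a] by (auto simp: e_def)
  have e_hs: "e s \<in> hspace d {k}" for s by (simp add: hspace_def e_def)
  have f_hs: "f s \<in> hspace d (?I - {k})" for s by (simp add: hspace_def f_def c_def)
  have "schmidt_decomposition d n k psi M lam e f"
    unfolding schmidt_decomposition_def
  proof (intro conjI ballI)
    fix s assume "s \<in> {1..M}"
    then show "0 < lam s" using hN by (simp add: lam_def)
  next
    show "orthonormal_family d {k} {1..M} e"
      unfolding orthonormal_family_def
    proof (intro conjI ballI)
      fix s t assume s: "s \<in> {1..M}" and t: "t \<in> {1..M}"
      have "braket d {k} (e s) (e t) = cdot (d k) (v (h s)) (v (h t))"
        by (simp add: braket_def sum_multi_idx_single cdot_def e_pt[OF s] e_pt[OF t])
      then show "braket d {k} (e s) (e t) = (if s = t then 1 else 0)"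
        using v_orth hN(1)[OF s] hN(1)[OF t] h_inj[OF s t] by simp
    qed (rule e_hs)
  next
    show "orthonormal_family d (?I - {k}) {1..M} f"
      unfolding orthonormal_family_def
    proof (intro conjI ballI)
      fix s t assume s: "s \<in> {1..M}" and t: "t \<in> {1..M}"
      have "braket d (?I - {k}) (f s) (f t)
          = (\<Sum>y\<in>?B. cnj (c (h s) y) * c (h t) y) / (of_real (sqrt (lam s)) * of_real (sqrt (lam t)))"
        by (simp add: braket_def f_def sum_divide_distrib)
      also have "\<dots> = (if s = t then of_real (lam s) else 0) / (of_real (sqrt (lam s)) * of_real (sqrt (lam t)))"
        using c_orth[OF hN(1)[OF t] hN(1)[OF s]] h_inj[OF t s] by (simp add: lam_def)
      also have "\<dots> = (if s = t then 1 else 0)"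
        using hN(2)[OF s]
        by (cases "s = t") (simp_all add: lam_def less_imp_le flip: of_real_mult of_real_divide)
      finally show "braket d (?I - {k}) (f s) (f t) = (if s = t then 1 else 0)" .
    qed (rule f_hs)
  next
    show "psi = (\<lambda>x. \<Sum>s=1..M. schmidt_term d n k lam e f s x)"
    proof
      fix x
      show "psi x = (\<Sum>s=1..M. schmidt_term d n k lam e f s x)"
      proof (cases "x \<in> multi_idx d ?I")
        case False
        have "{k} \<union> (?I - {k}) = ?I" using k by auto
        then have "schmidt_term d n k lam e f s x = 0" for s
          using False unfolding schmidt_term_def tensor_def by simp
        then show ?thesis using False hspace_zero[OF psi] by simp
      next
        case True
        let ?y = "x(k := undefined)"
        have y: "?y \<in> ?B" using in_multi_idx_iff[OF k] True by blast
        have "psi x = (\<Sum>i<m. v i (x k) * c i ?y)" using psi_c[OF y, of "x k"] by simp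
        also have "\<dots> = (\<Sum>i\<in>N. v i (x k) * c i ?y)"
          by (intro sum.mono_neutral_right) (auto simp: N_def r_0)
        also have "\<dots> = (\<Sum>s=1..M. v (h s) (x k) * c (h s) ?y)"
          by (rule sum.reindex_bij_betw[OF h, symmetric])
        also have "\<dots> = (\<Sum>s=1..M. schmidt_term d n k lam e f s x)"
        proof (intro sum.cong refl)
          fix s assume s: "s \<in> {1..M}"
          have "sqrt (lam s) \<noteq> 0" using hN(2)[OF s] by (simp add: lam_def)
          then show "v (h s) (x k) * c (h s) ?y = schmidt_term d n k lam e f s x"
            unfolding schmidt_term_def tensor_single[OF k e_hs f_hs] e_pt[OF s] f_def by simp
        qed
        finally show ?thesis .
      qed
    qed
  qed
  moreover have "\<forall>s\<in>{1..M}. \<exists>b. \<forall>a<d k. (\<Sum>y\<in>?B. phi (y(k := a)) * cnj (f s y)) = b * e s (pt k a)"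
    if phi: "phi \<in> R" for phi
  proof
    fix s assume s: "s \<in> {1..M}"
    have "gram d ?I k phi psi \<in> F" using phi by (simp add: F_def)
    then obtain t where t: "mvec (d k) (gram d ?I k phi psi) (v (h s)) = (\<lambda>a. t * v (h s) a)"
      using eig hN(1)[OF s] by blast
    \<comment> \<open>Contracting \<open>phi\<close> with \<open>f s\<close> is, up to
      normalisation, applying \<open>gram phi psi\<close> to \<open>v (h s)\<close>, an
      eigenvector.\<close>
    have "(\<Sum>y\<in>?B. phi (y(k := a)) * cnj (f s y)) = t / of_real (sqrt (lam s)) * e s (pt k a)" for a
    proof -
      have "(\<Sum>y\<in>?B. phi (y(k := a)) * cnj (f s y))
          = (\<Sum>y\<in>?B. phi (y(k := a)) * cnj (\<Sum>b<d k. cnj (v (h s) b) * psi (y(k := b)))) / of_real (sqrt (lam s))"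
        unfolding sum_divide_distrib by (intro sum.cong refl) (simp add: f_def c_def)
      also have "\<dots> = mvec (d k) (gram d ?I k phi psi) (v (h s)) a / of_real (sqrt (lam s))"
        unfolding mvec_gram ..
      finally show ?thesis unfolding t e_pt[OF s] by simp
    qed
    then show "\<exists>b. \<forall>a<d k. (\<Sum>y\<in>?B. phi (y(k := a)) * cnj (f s y)) = b * e s (pt k a)" by blast
  qed
  ultimately show thesis by (rule that)
qed

section \<open>Phase changes as local operators, and distinct Schmidt coefficients\<close>

context schmidt
begin

text \<open>The operator is diagonal in the \<open>e i\<close> and kills their orthogonal
  complement; nothing is lost, as the \<open>k\<close>-part of \<open>psi\<close> lies in their
  span.\<close>

lemma weighted_act:
  "weighted w = act d k (\<lambda>a b. \<Sum>i=1..M. w i * ev i a * cnj (ev i b)) psi"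
proof
  fix x
  have psi_x: "psi (x(k := b)) = (\<Sum>j=1..M. ev j b * (sq j * f j (x(k := undefined))))" for b
    by (subst psi_weighted) (simp add: weighted_eq mult_ac)
  have "act d k (\<lambda>a b. \<Sum>i=1..M. w i * ev i a * cnj (ev i b)) psi x
      = (\<Sum>b<d k. \<Sum>i=1..M. w i * ev i (x k) * (cnj (ev i b) * (\<Sum>j=1..M. ev j b * (sq j * f j (x(k := undefined))))))"
    unfolding act_def psi_x sum_distrib_right[of _ "{1..M}"] by (intro sum.cong refl) (simp only: mult.assoc)
  also have "\<dots> = (\<Sum>i=1..M. \<Sum>b<d k. w i * ev i (x k) * (cnj (ev i b) * (\<Sum>j=1..M. ev j b * (sq j * f j (x(k := undefined))))))"
    by (rule sum.swap)
  also have "\<dots> = (\<Sum>i=1..M. w i * ev i (x k) * (sq i * f i (x(k := undefined))))"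
    by (intro sum.cong refl) (simp only: sum_ev_delta flip: sum_distrib_left)
  also have "\<dots> = weighted w x"
    unfolding weighted_eq by (intro sum.cong refl) (simp only: mult_ac)
  finally show "weighted w x = act d k (\<lambda>a b. \<Sum>i=1..M. w i * ev i a * cnj (ev i b)) psi x" ..
qed

lemma gram_psi: "gram d {1..n} k u psi a b
    = (\<Sum>j=1..M. sq j * cnj (ev j b) * (\<Sum>y\<in>multi_idx d ({1..n} - {k}). u (y(k := a)) * cnj (f j y)))"
proof -
  let ?B = "multi_idx d ({1..n} - {k})"
  have "gram d {1..n} k u psi a b = (\<Sum>y\<in>?B. \<Sum>j=1..M. sq j * cnj (ev j b) * (u (y(k := a)) * cnj (f j y)))"
    unfolding gram_def
    by (intro sum.cong refl, subst psi_weighted) (simp add: weighted_upd sum_distrib_left mult_ac)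
  also have "\<dots> = (\<Sum>j=1..M. \<Sum>y\<in>?B. sq j * cnj (ev j b) * (u (y(k := a)) * cnj (f j y)))"
    by (rule sum.swap)
  finally show ?thesis by (simp only: sum_distrib_left)
qed

lemma mvec_gram_psi: "mvec (d k) (gram d {1..n} k u psi) z a
    = (\<Sum>j=1..M. sq j * cdot (d k) (ev j) z * (\<Sum>y\<in>multi_idx d ({1..n} - {k}). u (y(k := a)) * cnj (f j y)))"
proof -
  let ?G = "\<lambda>j. \<Sum>y\<in>multi_idx d ({1..n} - {k}). u (y(k := a)) * cnj (f j y)"
  have "mvec (d k) (gram d {1..n} k u psi) z a = (\<Sum>b<d k. \<Sum>j=1..M. sq j * (cnj (ev j b) * z b) * ?G j)"
    unfolding mvec_def gram_psi sum_distrib_right[of _ "{1..M}"] by (intro sum.cong refl) (simp only: mult_ac)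
  also have "\<dots> = (\<Sum>j=1..M. \<Sum>b<d k. sq j * (cnj (ev j b) * z b) * ?G j)"
    by (rule sum.swap)
  also have "\<dots> = (\<Sum>j=1..M. sq j * cdot (d k) (ev j) z * ?G j)"
    unfolding cdot_def sum_distrib_left[of "sq _"] sum_distrib_right ..
  finally show ?thesis .
qed

lemma cdot_ev: "i \<in> {1..M} \<Longrightarrow> j \<in> {1..M} \<Longrightarrow> cdot (d k) (ev i) (ev j) = (if i = j then 1 else 0)"
  unfolding cdot_def by (rule ev_orthonormal)

lemma mvec_rho: "mvec (d k) (gram d {1..n} k psi psi) z
    = (\<lambda>a. \<Sum>j=1..M. complex_of_real (lam j) * cdot (d k) (ev j) z * ev j a)"
proof
  fix a
  show "mvec (d k) (gram d {1..n} k psi psi) z a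
    = (\<Sum>j=1..M. complex_of_real (lam j) * cdot (d k) (ev j) z * ev j a)"
    unfolding mvec_gram_psi
  proof (intro sum.cong refl)
    fix j assume j: "j \<in> {1..M}"
    have "(\<Sum>y\<in>multi_idx d ({1..n} - {k}). psi (y(k := a)) * cnj (f j y)) = sq j * ev j a"
      using sum_f_weighted[OF j, of "\<lambda>_. 1" a] by (simp flip: psi_weighted)
    then show "sq j * cdot (d k) (ev j) z * (\<Sum>y\<in>multi_idx d ({1..n} - {k}). psi (y(k := a)) * cnj (f j y))
        = complex_of_real (lam j) * cdot (d k) (ev j) z * ev j a"
      by (simp add: sq_sq[OF j, symmetric] mult_ac)
  qed
qed

text \<open>\<open>gram phi psi\<close> commutes with the reduced state, whose positive eigenvalues
  are simple for injective \<open>lam\<close>, so it maps each \<open>e i\<close> to a multiple of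
  itself. Hence the given decomposition fits every \<open>phi\<close>.\<close>

lemma inj_imp_weighted:
  assumes n: "2 \<le> n" and phi: "phi \<in> same_marginals d n psi" and inj: "inj_on lam {1..M}"
  shows "\<exists>w. (\<forall>i\<in>{1..M}. cmod (w i) = 1) \<and> phi = weighted w"
proof (rule eigen_imp_weighted[OF phi], rule ballI)
  fix i assume i: "i \<in> {1..M}"
  define g where "g a = (\<Sum>y\<in>multi_idx d ({1..n} - {k}). phi (y(k := a)) * cnj (f i y))" for a
  let ?rho = "gram d {1..n} k psi psi" and ?T = "gram d {1..n} k phi psi"
  have T: "mvec (d k) ?T (ev i) = (\<lambda>a. sq i * g a)"
  proof
    fix a
    have "mvec (d k) ?T (ev i) a = (\<Sum>j=1..M. (if j = i then sq i * g a else 0))"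
      unfolding mvec_gram_psi by (intro sum.cong refl) (auto simp: cdot_ev[OF _ i] g_def)
    then show "mvec (d k) ?T (ev i) a = sq i * g a" using i by simp
  qed
  have rho_ev: "mvec (d k) ?rho (ev i) = (\<lambda>a. complex_of_real (lam i) * ev i a)"
  proof
    fix a
    have "mvec (d k) ?rho (ev i) a = (\<Sum>j=1..M. (if j = i then complex_of_real (lam i) * ev i a else 0))"
      unfolding mvec_rho by (intro sum.cong refl) (auto simp: cdot_ev[OF _ i])
    then show "mvec (d k) ?rho (ev i) a = complex_of_real (lam i) * ev i a" using i by simp
  qed
  have "mvec (d k) ?rho (mvec (d k) ?T (ev i)) = mvec (d k) ?T (mvec (d k) ?rho (ev i))"
    unfolding mvec_mmult[symmetric] gram_commute_rho[OF n psi_hspace k phi] ..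
  then have "(\<lambda>a. sq i * mvec (d k) ?rho g a) = (\<lambda>a. complex_of_real (lam i) * (sq i * g a))"
    unfolding T rho_ev mvec_scale .
  then have rho_g: "mvec (d k) ?rho g = (\<lambda>a. complex_of_real (lam i) * g a)"
    using sq_nz[OF i] by (auto simp: fun_eq_iff)
  \<comment> \<open>Evaluating the inner product of \<open>ev j\<close> with \<open>?rho\<close>
    applied to \<open>g\<close> in two ways shows that \<open>lam i - lam j\<close> times
    \<open>cdot (d k) (ev j) g\<close> is 0.\<close>
  have off: "cdot (d k) (ev j) g = 0" if j: "j \<in> {1..M}" "j \<noteq> i" for j
  proof -
    have "complex_of_real (lam i) * cdot (d k) (ev j) g = cdot (d k) (ev j) (mvec (d k) ?rho g)"
      unfolding rho_g cdot_scale_right ..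
    also have "\<dots> = (\<Sum>l=1..M. complex_of_real (lam l) * cdot (d k) (ev l) g * cdot (d k) (ev j) (ev l))"
      unfolding mvec_rho cdot_sum_right cdot_scale_right ..
    also have "\<dots> = (\<Sum>l=1..M. (if l = j then complex_of_real (lam j) * cdot (d k) (ev j) g else 0))"
      by (intro sum.cong refl) (auto simp: cdot_ev[OF j(1)])
    also have "\<dots> = complex_of_real (lam j) * cdot (d k) (ev j) g" using j by simp
    finally have "lam i = lam j \<or> cdot (d k) (ev j) g = 0" by auto
    then show ?thesis using inj_onD[OF inj, of i j] i j by auto
  qed
  \<comment> \<open>As \<open>lam i\<close> is positive, \<open>g\<close> lies in the range of the
    reduced state and has no component orthogonal to all \<open>ev l\<close>.\<close>
  have "complex_of_real (lam i) * g a = complex_of_real (lam i) * (cdot (d k) (ev i) g * ev i a)" for a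
  proof -
    have "complex_of_real (lam i) * g a = (\<Sum>l=1..M. complex_of_real (lam l) * cdot (d k) (ev l) g * ev l a)"
      using fun_cong[OF rho_g, of a] unfolding mvec_rho by simp
    also have "\<dots> = (\<Sum>l=1..M. (if l = i then complex_of_real (lam i) * cdot (d k) (ev i) g * ev i a else 0))"
      by (intro sum.cong refl) (auto simp: off)
    finally show ?thesis using i by simp
  qed
  then have "g a = cdot (d k) (ev i) g * ev i a" for a using lam_pos[OF i] by auto
  then show "\<exists>c. \<forall>a<d k. (\<Sum>y\<in>multi_idx d ({1..n} - {k}). phi (y(k := a)) * cnj (f i y)) = c * ev i a"
    unfolding g_def by blast
qed

lemma weighted_const: "weighted (\<lambda>_. c) = (\<lambda>x. c * psi x)"
  by (subst psi_weighted) (simp add: weighted_def sum_distrib_left)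

lemma weighted_cong: "(\<And>i. i \<in> {1..M} \<Longrightarrow> w i = w' i) \<Longrightarrow> weighted w = weighted w'"
  unfolding weighted_def by (intro ext sum.cong refl) simp

lemma M_pos: "1 \<in> {1..M}"
  using sum_lam by (cases "M = 0") auto

text \<open>Constant unit weights give only a global phase and an overlap of modulus 1. So the
  weights take at least two values, and their level sets form a partition.\<close>

lemma partition_of_weighted:
  assumes w: "\<forall>i\<in>{1..M}. cmod (w i) = 1" and same: "weighted w \<in> same_marginals d n psi"
    and ne: "cmod (braket d {1..n} (weighted w) psi) \<noteq> 1"
  shows "\<exists>L S. locally_orthogonal_partition d n k M f L S"
proof -
  have "\<exists>r\<in>{1..M}. \<exists>t\<in>{1..M}. w r \<noteq> w t"
  proof (rule ccontr)
    assume "\<not> ?thesis"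
    then have "weighted w = weighted (\<lambda>_. w 1)" using M_pos by (intro weighted_cong) blast
    then have "braket d {1..n} (weighted w) psi = cnj (w 1) * braket d {1..n} psi psi"
      unfolding weighted_const by (simp add: braket_def sum_distrib_left mult_ac)
    then show False using ne pure w M_pos by (simp add: pure_state_def)
  qed
  then have "weighted w \<in> block_phase_states d n k M lam e f"
    using weighted_in_block_phase_states[OF w same] by blast
  then show ?thesis unfolding block_phase_states_def by blast
qed

end

section \<open>Decompositions adapted to commuting families of states\<close>

lemma weighted_exists:
  assumes n: "2 \<le> n" and pure: "pure_state d {1..n} psi" and k: "k \<in> {1..n}"
    and R: "R \<subseteq> same_marginals d n psi"
    and comm: "\<And>phi phi'. phi \<in> R \<Longrightarrow> phi' \<in> R \<Longrightarrow>
      mmult (d k) (gram d {1..n} k phi psi) (gram d {1..n} k phi' psi)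
      = mmult (d k) (gram d {1..n} k phi' psi) (gram d {1..n} k phi psi)"
  obtains M lam e f where "schmidt d n k psi M lam e f"
    and "\<forall>phi\<in>R. \<exists>w. (\<forall>i\<in>{1..M}. cmod (w i) = 1) \<and> phi = schmidt.weighted d n k M lam e f w"
proof -
  obtain M lam e f where dec: "schmidt_decomposition d n k psi M lam e f"
    and eig: "\<And>phi. phi \<in> R \<Longrightarrow> \<forall>i\<in>{1..M}. \<exists>c. \<forall>a<d k.
      (\<Sum>y\<in>multi_idx d ({1..n} - {k}). phi (y(k := a)) * cnj (f i y)) = c * e i (pt k a)"
    using schmidt_decomposition_exists[OF n pure k R comm] by blast
  interpret schmidt d n k psi M lam e f
    by unfold_locales (fact k pure dec)+
  show thesis
  proof (rule that)
    show "schmidt d n k psi M lam e f" by unfold_locales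
    show "\<forall>phi\<in>R. \<exists>w. (\<forall>i\<in>{1..M}. cmod (w i) = 1) \<and> phi = weighted w"
      using eigen_imp_weighted R eig unfolding ev_def by blast
  qed
qed

text \<open>A family of one state commutes trivially, at the price of a decomposition that depends
  on \<open>phi\<close>.\<close>

lemma weighted_exists_single:
  assumes n: "2 \<le> n" and pure: "pure_state d {1..n} psi" and k: "k \<in> {1..n}"
    and phi: "phi \<in> same_marginals d n psi"
  obtains M lam e f w where "schmidt d n k psi M lam e f"
    and "\<forall>i\<in>{1..M}. cmod (w i) = 1" and "phi = schmidt.weighted d n k M lam e f w"
proof (rule weighted_exists[OF n pure k, of "{phi}"])
  show "{phi} \<subseteq> same_marginals d n psi" using phi by simp
  fix M lam e f
  assume "schmidt d n k psi M lam e f"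
    and "\<forall>chi\<in>{phi}. \<exists>w. (\<forall>i\<in>{1..M}. cmod (w i) = 1) \<and> chi = schmidt.weighted d n k M lam e f w"
  then show thesis using that by blast
qed simp

text \<open>The party \<open>k\<close> is free: the same \<open>phi\<close> comes from
  \<open>psi\<close> by a local operator on whichever party is chosen.\<close>

lemma same_marginals_act:
  assumes n: "2 \<le> n" and pure: "pure_state d {1..n} psi" and k: "k \<in> {1..n}"
    and phi: "phi \<in> same_marginals d n psi"
  shows "\<exists>U. phi = act d k U psi"
proof -
  obtain M lam e f w where s: "schmidt d n k psi M lam e f"
    and w: "phi = schmidt.weighted d n k M lam e f w"
    by (rule weighted_exists_single[OF assms])
  interpret schmidt d n k psi M lam e f by (rule s)
  show ?thesis unfolding w using weighted_act by blast
qed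

text \<open>With at least three parties, two states with the marginals of \<open>psi\<close> arise from \<open>psi\<close> by
  operators on any chosen party; moving them to two further parties makes them commute.\<close>

lemma gram_commute:
  assumes n: "3 \<le> n" and pure: "pure_state d {1..n} psi" and k: "k \<in> {1..n}"
    and phi: "phi \<in> same_marginals d n psi" and chi: "chi \<in> same_marginals d n psi"
  shows "mmult (d k) (gram d {1..n} k phi psi) (gram d {1..n} k chi psi)
      = mmult (d k) (gram d {1..n} k chi psi) (gram d {1..n} k phi psi)"
proof -
  have n2: "2 \<le> n" using n by simp
  have psi: "psi \<in> hspace d {1..n}" using pure by (simp add: pure_state_def)
  have "\<exists>j l. j \<in> {1..n} \<and> l \<in> {1..n} \<and> j \<noteq> k \<and> l \<noteq> k \<and> j \<noteq> l"
  proof -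
    have "card ({1, 2, 3} - {k}) \<ge> 2" by (cases "k \<in> {1, 2, 3}") auto
    then obtain j l where "j \<in> {1, 2, 3} - {k}" "l \<in> {1, 2, 3} - {k}" "j \<noteq> l"
      by (metis card_le_Suc0_iff_eq finite.emptyI finite_Diff finite_insert not_less_eq_eq numeral_2_eq_2)
    then show ?thesis using n by (intro exI[of _ j] exI[of _ l]) auto
  qed
  then obtain j l where j: "j \<in> {1..n}" "j \<noteq> k" and l: "l \<in> {1..n}" "l \<noteq> k" and jl: "j \<noteq> l"
    by blast
  obtain U where U: "phi = act d k U psi" using same_marginals_act[OF n2 pure k phi] by blast
  obtain U' where U': "chi = act d k U' psi" using same_marginals_act[OF n2 pure k chi] by blast
  obtain V where V: "phi = act d j V psi" using same_marginals_act[OF n2 pure j(1) phi] by blast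
  obtain V' where V': "chi = act d l V' psi" using same_marginals_act[OF n2 pure l(1) chi] by blast
  \<comment> \<open>Each state is rewritten by an operator on another party so that two operators
    can pass each other: \<open>U\<close> and \<open>V'\<close>, then \<open>V'\<close> and
    \<open>V\<close>, then \<open>V\<close> and \<open>U'\<close>.\<close>
  have "act d k U chi = act d l V' phi" by (subst V', subst U) (rule act_commute[OF l(2)])
  also have "\<dots> = act d j V chi" by (subst V, subst V') (rule act_commute[OF jl])
  also have "\<dots> = act d k U' phi" by (subst U', subst V) (rule act_commute[OF j(2), symmetric])
  finally have UU: "act d k U chi = act d k U' phi" .
  let ?rho = "gram d {1..n} k psi psi"
  have T: "gram d {1..n} k phi psi = mmult (d k) U ?rho" unfolding U by (rule gram_act)
  have T': "gram d {1..n} k chi psi = mmult (d k) U' ?rho" unfolding U' by (rule gram_act)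
  \<comment> \<open>The first factor is \<open>U\<close> times \<open>?rho\<close>. Moving
    \<open>?rho\<close> to the right past the second factor exposes \<open>U\<close> acting on
    \<open>chi\<close>, where \<open>UU\<close> exchanges the roles of the two states.\<close>
  have "mmult (d k) (gram d {1..n} k phi psi) (gram d {1..n} k chi psi)
      = mmult (d k) U (mmult (d k) (gram d {1..n} k chi psi) ?rho)"
    unfolding T mmult_assoc gram_commute_rho[OF n2 psi k chi] ..
  also have "\<dots> = mmult (d k) (gram d {1..n} k (act d k U chi) psi) ?rho"
    unfolding gram_act mmult_assoc ..
  also have "\<dots> = mmult (d k) U' (mmult (d k) (gram d {1..n} k phi psi) ?rho)"
    unfolding UU gram_act mmult_assoc ..
  also have "\<dots> = mmult (d k) (gram d {1..n} k chi psi) (gram d {1..n} k phi psi)"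
    unfolding T' mmult_assoc gram_commute_rho[OF n2 psi k phi] ..
  finally show ?thesis .
qed

theorem theorem2:
  fixes d :: "nat \<Rightarrow> nat" and n :: nat and psi :: qvec
  assumes "2 \<le> n"
    and "pure_state d {1..n} psi"
  shows
    "(locally_undetermined d n psi \<longrightarrow>
        (\<forall>k\<in>{1..n}.
          (\<exists>M lam e f.
             schmidt_decomposition d n k psi M lam e f \<and>
             (\<exists>L S. locally_orthogonal_partition d n k M f L S) \<and>
             (3 \<le> n \<or> inj_on lam {1..M} \<longrightarrow>
                same_marginals d n psi = block_phase_states d n k M lam e f)) \<and>
          same_marginals d n psi =
            {phi. \<exists>M lam e f. schmidt_decomposition d n k psi M lam e f \<and>
                    phi \<in> block_phase_states d n k M lam e f}))
     \<and> ((\<exists>k\<in>{1..n}. \<exists>M lam e f L S.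
            schmidt_decomposition d n k psi M lam e f \<and>
            locally_orthogonal_partition d n k M f L S)
         \<longrightarrow> locally_undetermined d n psi)"
proof (intro conjI impI ballI)
  assume "\<exists>k\<in>{1..n}. \<exists>M lam e f L S. schmidt_decomposition d n k psi M lam e f \<and>
      locally_orthogonal_partition d n k M f L S"
  then obtain k M lam e f L S where "k \<in> {1..n}" "schmidt_decomposition d n k psi M lam e f"
    and S: "locally_orthogonal_partition d n k M f L S" by blast
  then interpret schmidt d n k psi M lam e f
    using assms(2) by unfold_locales
  show "locally_undetermined d n psi" by (rule locally_undetermined_of_partition[OF S])
next
  fix k assume und: "locally_undetermined d n psi" and k: "k \<in> {1..n}"
  obtain phi0 where phi0: "phi0 \<in> same_marginals d n psi" "cmod (braket d {1..n} phi0 psi) \<noteq> 1"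
    using und unfolding locally_undetermined_def by blast
  \<comment> \<open>For two parties the operators of different states need not commute, so only the
    witness \<open>phi0\<close> is diagonalised; it suffices to produce a partition.\<close>
  define R where "R = (if 3 \<le> n then same_marginals d n psi else {phi0})"
  have R: "R \<subseteq> same_marginals d n psi" "phi0 \<in> R" using phi0 by (simp_all add: R_def)
  have comm: "mmult (d k) (gram d {1..n} k phi psi) (gram d {1..n} k chi psi)
      = mmult (d k) (gram d {1..n} k chi psi) (gram d {1..n} k phi psi)"
    if "phi \<in> R" "chi \<in> R" for phi chi
  proof (cases "3 \<le> n")
    case True
    then show ?thesis using that gram_commute[OF True assms(2) k] by (simp add: R_def)
  next
    case False
    then show ?thesis using that by (simp add: R_def)
  qed
  obtain M lam e f where s: "schmidt d n k psi M lam e f"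
    and wR: "\<forall>phi\<in>R. \<exists>w. (\<forall>i\<in>{1..M}. cmod (w i) = 1) \<and> phi = schmidt.weighted d n k M lam e f w"
    by (rule weighted_exists[OF assms k R(1) comm])
  interpret schmidt d n k psi M lam e f by (rule s)
  have part: "\<exists>L S. locally_orthogonal_partition d n k M f L S"
    using bspec[OF wR R(2)] partition_of_weighted phi0 by blast
  have in_block: "phi \<in> block_phase_states d n k M lam e f"
    if "phi \<in> same_marginals d n psi" "\<exists>w. (\<forall>i\<in>{1..M}. cmod (w i) = 1) \<and> phi = weighted w" for phi
    using that weighted_in_block_phase_states part by blast
  have "same_marginals d n psi = block_phase_states d n k M lam e f" if "3 \<le> n \<or> inj_on lam {1..M}"
  proof (rule antisym[OF _ block_phase_states_subset], rule subsetI)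
    fix phi assume phi: "phi \<in> same_marginals d n psi"
    have "\<exists>w. (\<forall>i\<in>{1..M}. cmod (w i) = 1) \<and> phi = weighted w"
      using that
    proof
      assume "3 \<le> n"
      then show ?thesis using wR phi by (simp add: R_def)
    next
      assume "inj_on lam {1..M}"
      then show ?thesis by (rule inj_imp_weighted[OF assms(1) phi])
    qed
    with phi show "phi \<in> block_phase_states d n k M lam e f" by (rule in_block)
  qed
  with part schmidt
  show "\<exists>M lam e f. schmidt_decomposition d n k psi M lam e f \<and>
      (\<exists>L S. locally_orthogonal_partition d n k M f L S) \<and>
      (3 \<le> n \<or> inj_on lam {1..M} \<longrightarrow> same_marginals d n psi = block_phase_states d n k M lam e f)"
    by blast
  show "same_marginals d n psi =
      {phi. \<exists>M lam e f. schmidt_decomposition d n k psi M lam e f \<and>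
              phi \<in> block_phase_states d n k M lam e f}"
  proof (intro equalityI subsetI CollectI)
    fix phi assume "phi \<in> {phi. \<exists>M lam e f. schmidt_decomposition d n k psi M lam e f \<and>
              phi \<in> block_phase_states d n k M lam e f}"
    then obtain M' lam' e' f' where dec: "schmidt_decomposition d n k psi M' lam' e' f'"
      and phi: "phi \<in> block_phase_states d n k M' lam' e' f'" by blast
    interpret other: schmidt d n k psi M' lam' e' f'
      using assms(2) k dec by unfold_locales
    show "phi \<in> same_marginals d n psi" using phi other.block_phase_states_subset by blast
  next
    fix phi assume phi: "phi \<in> same_marginals d n psi"
    obtain M' lam' e' f' w where s': "schmidt d n k psi M' lam' e' f'"
      and w: "\<forall>i\<in>{1..M'}. cmod (w i) = 1" "phi = schmidt.weighted d n k M' lam' e' f' w"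
      by (rule weighted_exists_single[OF assms k phi])
    interpret other: schmidt d n k psi M' lam' e' f' by (rule s')
    show "\<exists>M lam e f. schmidt_decomposition d n k psi M lam e f \<and>
        phi \<in> block_phase_states d n k M lam e f"
    proof (cases "\<exists>r\<in>{1..M'}. \<exists>t\<in>{1..M'}. w r \<noteq> w t")
      case True
      then show ?thesis
        using other.weighted_in_block_phase_states[OF w(1)] phi w(2) other.schmidt by blast
    next
      \<comment> \<open>\<open>phi\<close> is then a multiple of \<open>psi\<close> and has constant
        weights in any decomposition; the one adapted to \<open>phi0\<close> is chosen because it is
        known to admit a partition.\<close>
      case False
      then have "phi = other.weighted (\<lambda>_. w 1)"
        unfolding w(2) using other.M_pos by (intro other.weighted_cong) blast
      then have "phi = weighted (\<lambda>_. w 1)" unfolding weighted_const other.weighted_const .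
      moreover have "cmod (w 1) = 1" using w(1) other.M_pos by blast
      ultimately have "\<exists>w. (\<forall>i\<in>{1..M}. cmod (w i) = 1) \<and> phi = weighted w"
        by (intro exI[of _ "\<lambda>_. w 1"]) simp
      then have "phi \<in> block_phase_states d n k M lam e f" by (rule in_block[OF phi])
      then show ?thesis using schmidt by blast
    qed
  qed
qed

end
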